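(* Let $X$ be a quasi-projective complex manifold, $f$ a non-invertible holomorphic function on $X$, $\mathcal S$ a simple regular holonomic left $\mathcal D_X$-module with $\mathcal M:=\mathcal S_f\ne0$, and $\alpha\in\mathbb C$. For any $m\in\mathcal M$, one has $\omega_{m,\alpha}\le\nu_{m,\alpha}$.
   Context: $\mathcal S_f$ is the localization along $\{f=0\}$; $f$ acts bijectively on $\mathcal M$. $\mathcal M[s]f^s$ has the left $\mathcal D_X[s]$-action $\xi\cdot(ms^jf^s)=\bigl(\xi(m)s^j+ms^{j+1}\tfrac{\xi(f)}{f}\bigr)f^s$ for vector fields $\xi$, with $s$ acting by multiplication. For $k\in\mathbb Z$, $mf^{s+k}:=(f^km)f^s$. For $k\ge1$, the $k$-th power $b$-function $b_m^{(k)}(s)\in\mathbb C[s]$ is the monic polynomial of minimal degree such that $P\cdot mf^{s+k}=b_m^{(k)}(s)mf^s$ for some $P\in\mathcal D_X[s]$. The sequence $\operatorname{mult}_{s=-\alpha}b_m^{(k)}(s)$ (multiplicity of $-\alpha$ as a root) is non-decreasing in $k$ and bounded, and $\nu_{m,\alpha}:=\lim_{k\to\infty}\operatorname{mult}_{s=-\alpha}b_m^{(k)}(s)$. For an integer $k\ge0$, $\ell_k$ is the minimal integer $\ell\ge0$ for which there is $P\in\mathcal D_X[s]$ with $$P\cdot mf^{s+k}\equiv(s+\alpha)^\ell mf^s\pmod{(s+\alpha)^{\ell+1}\cdot\mathcal M[s]f^s}.$$ The sequence $(\ell_k)_k$ stabilizes, and $\omega_{m,\alpha}:=\lim_{k\to\infty}\ell_k$.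 *)

theory Defs
  imports "HOL-Analysis.Analysis" "HOL-Library.Function_Algebras"
    "HOL-Computational_Algebra.Polynomial"
begin

section \<open>Complex manifolds\<close>

text \<open>The dimension must be allowed to vary, so complex n-space is modelled (like
  \<open>Euclidean_space n\<close> in the library) by the sequences vanishing from index n on, with the topology
  induced by the product topology.\<close>

definition cspace :: "nat \<Rightarrow> (nat \<Rightarrow> complex) set" where
  "cspace n = {v. \<forall>i\<ge>n. v i = 0}"

text \<open>For open W in complex n-space: continuous and holomorphic in each variable separately
  (equivalent to local expansion in power series by Osgood's lemma).\<close>

definition holo :: "nat \<Rightarrow> (nat \<Rightarrow> complex) set \<Rightarrow> ((nat \<Rightarrow> complex) \<Rightarrow> complex) \<Rightarrow> bool" where
  "holo n W h \<longleftrightarrow> continuous_on W h \<and>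
     (\<forall>v\<in>W. \<forall>i<n. (\<lambda>z. h (v(i := z))) field_differentiable (at (v i)))"

definition pd :: "nat \<Rightarrow> ((nat \<Rightarrow> complex) \<Rightarrow> complex) \<Rightarrow> (nat \<Rightarrow> complex) \<Rightarrow> complex" where
  "pd k h v = deriv (\<lambda>z. h (v(k := z))) (v k)"

text \<open>The Jacobian of the first N components of F is injective at all points of W.\<close>

definition immersive :: "nat \<Rightarrow> nat \<Rightarrow> (nat \<Rightarrow> complex) set
    \<Rightarrow> ((nat \<Rightarrow> complex) \<Rightarrow> nat \<Rightarrow> complex) \<Rightarrow> bool" where
  "immersive d N W F \<longleftrightarrow>
     (\<forall>v\<in>W. \<forall>t\<in>cspace d. (\<forall>i<N. (\<Sum>k<d. t k * pd k (\<lambda>v. F v i) v) = 0) \<longrightarrow> t = 0)"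

text \<open>A chart is a pair of its open domain and its coordinate map (only relevant on the domain).\<close>

type_synonym 'x chart = "'x set \<times> ('x \<Rightarrow> nat \<Rightarrow> complex)"

record 'x cmanifold =
  mtop :: "'x topology"
  mdim :: nat
  charts :: "'x chart set"

definition complex_manifold :: "'x cmanifold \<Rightarrow> bool" where
  "complex_manifold X \<longleftrightarrow>
     Hausdorff_space (mtop X) \<and> second_countable (mtop X) \<and>
     (\<Union>(C, \<phi>)\<in>charts X. C) = topspace (mtop X) \<and>
     (\<forall>(C, \<phi>)\<in>charts X. openin (mtop X) C \<and>
        openin (top_of_set (cspace (mdim X))) (\<phi> ` C) \<and>
        homeomorphic_map (subtopology (mtop X) C) (top_of_set (\<phi> ` C)) \<phi>) \<and>
     (\<forall>(C, \<phi>)\<in>charts X. \<forall>(C', \<phi>')\<in>charts X. \<forall>i<mdim X.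
        holo (mdim X) (\<phi> ` (C \<inter> C')) (\<lambda>v. \<phi>' (inv_into C \<phi> v) i))"

text \<open>The structure sheaf. A function on the open set U is represented by its extension by zero to
  the whole type, so restriction (\<open>rs\<close>) is cutting off.\<close>

type_synonym 'x lfun = "'x \<Rightarrow> complex"

definition rs :: "'x set \<Rightarrow> 'x lfun \<Rightarrow> 'x lfun" where
  "rs V g = (\<lambda>x. if x \<in> V then g x else 0)"

definition hol :: "'x cmanifold \<Rightarrow> 'x set \<Rightarrow> 'x lfun set" where
  "hol X U = {g. (\<forall>x. x \<notin> U \<longrightarrow> g x = 0) \<and>
     (\<forall>(C, \<phi>)\<in>charts X. holo (mdim X) (\<phi> ` (C \<inter> U)) (\<lambda>v. g (inv_into C \<phi> v)))}"

inductive_set polyfun :: "nat \<Rightarrow> ((nat \<Rightarrow> complex) \<Rightarrow> complex) set" for r :: nat where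
  const: "(\<lambda>w. c) \<in> polyfun r"
| var: "i < r \<Longrightarrow> (\<lambda>w. w i) \<in> polyfun r"
| add: "p \<in> polyfun r \<Longrightarrow> q \<in> polyfun r \<Longrightarrow> (\<lambda>w. p w + q w) \<in> polyfun r"
| mult: "p \<in> polyfun r \<Longrightarrow> q \<in> polyfun r \<Longrightarrow> (\<lambda>w. p w * q w) \<in> polyfun r"

definition hompoly :: "nat \<Rightarrow> ((nat \<Rightarrow> complex) \<Rightarrow> complex) set" where
  "hompoly r = {p \<in> polyfun r. \<exists>d. \<forall>c w. p (\<lambda>i. c * w i) = c ^ d * p w}"

text \<open>X admits a holomorphic embedding x \<open>\<mapsto>\<close> [h x] into projective N-space whose image is locally
  closed in the Zariski topology. Here h x is an arbitrary choice of homogeneous coordinates (not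
  required to be continuous in x); the analytic conditions are imposed on the quotients of
  coordinates, i.e. in the standard affine charts of projective space.\<close>

definition quasi_projective :: "'x cmanifold \<Rightarrow> bool" where
  "quasi_projective X \<longleftrightarrow> (\<exists>N h.
     (\<forall>x\<in>topspace (mtop X). h x \<in> cspace (Suc N) \<and> h x \<noteq> 0) \<and>
     (\<forall>x\<in>topspace (mtop X). \<forall>y\<in>topspace (mtop X). \<forall>c. h x = (\<lambda>i. c * h y i) \<longrightarrow> x = y) \<and>
     (\<exists>A\<subseteq>hompoly (Suc N). \<exists>B\<subseteq>hompoly (Suc N). \<forall>w\<in>cspace (Suc N). w \<noteq> 0 \<longrightarrow>
        ((\<exists>x\<in>topspace (mtop X). \<exists>c. w = (\<lambda>i. c * h x i)) \<longleftrightarrow>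
           (\<forall>p\<in>A. p w = 0) \<and> (\<exists>q\<in>B. q w \<noteq> 0))) \<and>
     (\<forall>j\<le>N. let U = {x \<in> topspace (mtop X). h x j \<noteq> 0}; a = (\<lambda>x i. h x i / h x j) in
        openin (mtop X) U \<and>
        (\<forall>i\<le>N. rs U (\<lambda>x. a x i) \<in> hol X U) \<and>
        embedding_map (subtopology (mtop X) U) euclidean a \<and>
        (\<forall>(C, \<phi>)\<in>charts X.
           immersive (mdim X) (Suc N) (\<phi> ` (C \<inter> U)) (\<lambda>v. a (inv_into C \<phi> v)))))"


section \<open>The sheaf of differential operators\<close>

text \<open>An endomorphism P of the sheaf of holomorphic functions on U is the family of its components
  P W for open W in U, normalised to be zero for all other arguments. Addition of such families is
  the pointwise one of \<open>Function_Algebras\<close>; the product of operators is \<open>dcomp\<close> (not the pointwise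
  product).\<close>

type_synonym 'x dop = "'x set \<Rightarrow> 'x lfun \<Rightarrow> 'x lfun"

definition sheaf_end :: "'x cmanifold \<Rightarrow> 'x set \<Rightarrow> 'x dop set" where
  "sheaf_end X U = {P.
     (\<forall>W g. \<not> (openin (mtop X) W \<and> W \<subseteq> U \<and> g \<in> hol X W) \<longrightarrow> P W g = 0) \<and>
     (\<forall>W. openin (mtop X) W \<longrightarrow> W \<subseteq> U \<longrightarrow>
        (\<forall>g\<in>hol X W. P W g \<in> hol X W \<and>
           (\<forall>c. P W (\<lambda>x. c * g x) = (\<lambda>x. c * P W g x)) \<and>
           (\<forall>h\<in>hol X W. P W (g + h) = P W g + P W h) \<and>
           (\<forall>W'. openin (mtop X) W' \<longrightarrow> W' \<subseteq> W \<longrightarrow> P W' (rs W' g) = rs W' (P W g))))}"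

definition dcomp :: "'x dop \<Rightarrow> 'x dop \<Rightarrow> 'x dop" where
  "dcomp P Q = (\<lambda>W g. P W (Q W g))"

definition dres :: "'x set \<Rightarrow> 'x dop \<Rightarrow> 'x dop" where
  "dres V P = (\<lambda>W g. if W \<subseteq> V then P W g else 0)"

definition mop :: "'x cmanifold \<Rightarrow> 'x set \<Rightarrow> 'x lfun \<Rightarrow> 'x dop" where
  "mop X V g = (\<lambda>W h. if openin (mtop X) W \<and> W \<subseteq> V \<and> h \<in> hol X W then g * h else 0)"

definition vfields :: "'x cmanifold \<Rightarrow> 'x set \<Rightarrow> 'x dop set" where
  "vfields X V = {\<xi> \<in> sheaf_end X V. \<forall>W. openin (mtop X) W \<longrightarrow> W \<subseteq> V \<longrightarrow>
     (\<forall>g\<in>hol X W. \<forall>h\<in>hol X W. \<xi> W (g * h) = \<xi> W g * h + g * \<xi> W h)}"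

text \<open>The sheaf of differential operators is the subsheaf of rings of the endomorphism sheaf
  generated by functions and vector fields.\<close>

inductive_set dgen :: "'x cmanifold \<Rightarrow> 'x set \<Rightarrow> 'x dop set" for X V where
  func: "g \<in> hol X V \<Longrightarrow> mop X V g \<in> dgen X V"
| vf: "\<xi> \<in> vfields X V \<Longrightarrow> \<xi> \<in> dgen X V"
| add: "P \<in> dgen X V \<Longrightarrow> Q \<in> dgen X V \<Longrightarrow> P + Q \<in> dgen X V"
| comp: "P \<in> dgen X V \<Longrightarrow> Q \<in> dgen X V \<Longrightarrow> dcomp P Q \<in> dgen X V"

definition diffops :: "'x cmanifold \<Rightarrow> 'x set \<Rightarrow> 'x dop set" where
  "diffops X U = {P \<in> sheaf_end X U.
     \<forall>x\<in>U. \<exists>V. openin (mtop X) V \<and> x \<in> V \<and> V \<subseteq> U \<and> dres V P \<in> dgen X V}"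

text \<open>The order filtration; \<open>ford X 0\<close> is the structure sheaf, embedded as multiplication
  operators.\<close>

primrec ford :: "'x cmanifold \<Rightarrow> nat \<Rightarrow> 'x set \<Rightarrow> 'x dop set" where
  "ford X 0 = (\<lambda>U. mop X U ` hol X U)"
| "ford X (Suc p) = (\<lambda>U. {P \<in> diffops X U.
     \<forall>W g. openin (mtop X) W \<longrightarrow> W \<subseteq> U \<longrightarrow> g \<in> hol X W \<longrightarrow>
       dcomp (dres W P) (mop X W g) - dcomp (mop X W g) (dres W P) \<in> ford X p W})"

text \<open>The principal symbol of P of order at most p, at the cotangent vector with coordinates \<open>\<xi>\<close> at
  x in the chart \<open>(C, \<phi>)\<close>: it is \<open>ad(g)^p P / p!\<close>, a multiplication operator, for the linear
  function g with \<open>dg = \<xi>\<close>. For \<open>P = \<Sum> a\<^sub>\<beta> \<partial>\<^sup>\<beta>\<close> this is the sum of \<open>a\<^sub>\<beta>(x) \<xi>\<^sup>\<beta>\<close> over \<open>|\<beta>| = p\<close>.\<close>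

definition symb :: "'x cmanifold \<Rightarrow> nat \<Rightarrow> 'x dop \<Rightarrow> 'x set \<Rightarrow> 'x chart
    \<Rightarrow> 'x \<Rightarrow> (nat \<Rightarrow> complex) \<Rightarrow> complex" where
  "symb X p P V c x \<xi> = (case c of (C, \<phi>) \<Rightarrow>
     let W = V \<inter> C; g = rs W (\<lambda>y. \<Sum>i<mdim X. \<xi> i * \<phi> y i) in
     ((\<lambda>Q. dcomp Q (mop X W g) - dcomp (mop X W g) Q) ^^ p) (dres W P) W (rs W (\<lambda>y. 1)) x
       / fact p)"


section \<open>Sheaves of modules\<close>

text \<open>\<open>sec M V\<close> are the sections over V, \<open>res M U V\<close> is restriction from U to V, \<open>act M V P\<close> is the
  action of the operator P on sections over V. All sections live in one abelian group, whose
  addition induces the addition of the groups of sections.\<close>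

record ('x, 'm) dmodule =
  sec :: "'x set \<Rightarrow> 'm set"
  res :: "'x set \<Rightarrow> 'x set \<Rightarrow> 'm \<Rightarrow> 'm"
  act :: "'x set \<Rightarrow> 'x dop \<Rightarrow> 'm \<Rightarrow> 'm"

definition sheaf :: "'x cmanifold \<Rightarrow> ('x, 'm::ab_group_add) dmodule \<Rightarrow> bool" where
  "sheaf X M \<longleftrightarrow>
     (\<forall>U. openin (mtop X) U \<longrightarrow> 0 \<in> sec M U \<and>
        (\<forall>m\<in>sec M U. - m \<in> sec M U \<and> res M U U m = m \<and> (\<forall>m'\<in>sec M U. m + m' \<in> sec M U))) \<and>
     (\<forall>U V. openin (mtop X) U \<longrightarrow> openin (mtop X) V \<longrightarrow> V \<subseteq> U \<longrightarrow>
        (\<forall>m\<in>sec M U. res M U V m \<in> sec M V \<and>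
           (\<forall>m'\<in>sec M U. res M U V (m + m') = res M U V m + res M U V m') \<and>
           (\<forall>W. openin (mtop X) W \<longrightarrow> W \<subseteq> V \<longrightarrow> res M V W (res M U V m) = res M U W m))) \<and>
     (\<forall>\<U>. (\<forall>U\<in>\<U>. openin (mtop X) U) \<longrightarrow>
        (\<forall>m\<in>sec M (\<Union>\<U>). (\<forall>U\<in>\<U>. res M (\<Union>\<U>) U m = 0) \<longrightarrow> m = 0) \<and>
        (\<forall>\<sigma>. (\<forall>U\<in>\<U>. \<sigma> U \<in> sec M U) \<longrightarrow>
            (\<forall>U\<in>\<U>. \<forall>V\<in>\<U>. res M U (U \<inter> V) (\<sigma> U) = res M V (U \<inter> V) (\<sigma> V)) \<longrightarrow>
            (\<exists>m\<in>sec M (\<Union>\<U>). \<forall>U\<in>\<U>. res M (\<Union>\<U>) U m = \<sigma> U)))"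

definition D_module :: "'x cmanifold \<Rightarrow> ('x, 'm::ab_group_add) dmodule \<Rightarrow> bool" where
  "D_module X M \<longleftrightarrow> sheaf X M \<and>
     (\<forall>V. openin (mtop X) V \<longrightarrow> (\<forall>m\<in>sec M V.
        act M V (mop X V (rs V (\<lambda>x. 1))) m = m \<and>
        (\<forall>P\<in>diffops X V. act M V P m \<in> sec M V \<and>
           (\<forall>m'\<in>sec M V. act M V P (m + m') = act M V P m + act M V P m') \<and>
           (\<forall>Q\<in>diffops X V. act M V (P + Q) m = act M V P m + act M V Q m \<and>
              act M V (dcomp P Q) m = act M V P (act M V Q m)) \<and>
           (\<forall>W. openin (mtop X) W \<longrightarrow> W \<subseteq> V \<longrightarrow>
              res M V W (act M V P m) = act M W (dres W P) (res M V W m)))))"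

text \<open>N is a subsheaf over U of M stable under the sheaf of operators A, where A is
  \<open>diffops X\<close> or the structure sheaf \<open>ford X 0\<close>.\<close>

definition submodule_on :: "'x cmanifold \<Rightarrow> ('x set \<Rightarrow> 'x dop set) \<Rightarrow> ('x, 'm::ab_group_add) dmodule
    \<Rightarrow> 'x set \<Rightarrow> ('x set \<Rightarrow> 'm set) \<Rightarrow> bool" where
  "submodule_on X A M U N \<longleftrightarrow> (\<forall>V. openin (mtop X) V \<longrightarrow> V \<subseteq> U \<longrightarrow>
     N V \<subseteq> sec M V \<and> 0 \<in> N V \<and>
     (\<forall>m\<in>N V. (\<forall>m'\<in>N V. m + m' \<in> N V) \<and> (\<forall>P\<in>A V. act M V P m \<in> N V) \<and>
        (\<forall>W. openin (mtop X) W \<longrightarrow> W \<subseteq> V \<longrightarrow> res M V W m \<in> N W)) \<and>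
     (\<forall>m\<in>sec M V. (\<forall>x\<in>V. \<exists>W. openin (mtop X) W \<and> x \<in> W \<and> W \<subseteq> V \<and> res M V W m \<in> N W)
        \<longrightarrow> m \<in> N V))"

definition generates :: "'x cmanifold \<Rightarrow> ('x set \<Rightarrow> 'x dop set) \<Rightarrow> ('x, 'm::ab_group_add) dmodule
    \<Rightarrow> 'x set \<Rightarrow> 'm list \<Rightarrow> bool" where
  "generates X A M V G \<longleftrightarrow> set G \<subseteq> sec M V \<and>
     (\<forall>W. openin (mtop X) W \<longrightarrow> W \<subseteq> V \<longrightarrow> (\<forall>m\<in>sec M W. \<forall>x\<in>W.
        \<exists>W' a. openin (mtop X) W' \<and> x \<in> W' \<and> W' \<subseteq> W \<and> (\<forall>i<length G. a i \<in> A W') \<and>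
          res M W W' m = (\<Sum>i<length G. act M W' (a i) (res M V W' (G ! i)))))"

definition finite_type :: "'x cmanifold \<Rightarrow> ('x set \<Rightarrow> 'x dop set) \<Rightarrow> ('x, 'm::ab_group_add) dmodule
    \<Rightarrow> 'x set \<Rightarrow> bool" where
  "finite_type X A M U \<longleftrightarrow>
     (\<forall>x\<in>U. \<exists>V G. openin (mtop X) V \<and> x \<in> V \<and> V \<subseteq> U \<and> generates X A M V G)"

text \<open>The sheaf of relations between the sections G over V: the kernel of the map from the free
  A-module on G.\<close>

definition relations :: "('x set \<Rightarrow> 'x dop set) \<Rightarrow> ('x, 'm::ab_group_add) dmodule
    \<Rightarrow> 'x set \<Rightarrow> 'm list \<Rightarrow> ('x, nat \<Rightarrow> 'x dop) dmodule" where
  "relations A M V G =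
     \<lparr>sec = (\<lambda>W. {a. (\<forall>i<length G. a i \<in> A W) \<and> (\<forall>i\<ge>length G. a i = 0) \<and>
                (\<Sum>i<length G. act M W (a i) (res M V W (G ! i))) = 0}),
      res = (\<lambda>W W' a i. dres W' (a i)),
      act = (\<lambda>W P a i. dcomp P (a i))\<rparr>"

definition coherent :: "'x cmanifold \<Rightarrow> ('x set \<Rightarrow> 'x dop set) \<Rightarrow> ('x, 'm::ab_group_add) dmodule
    \<Rightarrow> 'x set \<Rightarrow> bool" where
  "coherent X A M U \<longleftrightarrow> finite_type X A M U \<and>
     (\<forall>V G. openin (mtop X) V \<longrightarrow> V \<subseteq> U \<longrightarrow> set G \<subseteq> sec M V \<longrightarrow>
        finite_type X A (relations A M V G) V)"

definition zero_module :: "'x cmanifold \<Rightarrow> ('x, 'm::ab_group_add) dmodule \<Rightarrow> bool" where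
  "zero_module X M \<longleftrightarrow> (\<forall>U. openin (mtop X) U \<longrightarrow> sec M U = {0})"

text \<open>Simplicity is meant in the category of coherent modules, as always for analytic D-modules:
  extensions by zero from open sets are submodules that are not coherent. Coherent submodules of
  regular holonomic modules are regular holonomic.\<close>

definition simple_module :: "'x cmanifold \<Rightarrow> ('x, 'm::ab_group_add) dmodule \<Rightarrow> bool" where
  "simple_module X M \<longleftrightarrow> \<not> zero_module X M \<and>
     (\<forall>N. submodule_on X (diffops X) M (topspace (mtop X)) N \<longrightarrow>
        coherent X (diffops X) (M\<lparr>sec := N\<rparr>) (topspace (mtop X)) \<longrightarrow>
        (\<forall>U. openin (mtop X) U \<longrightarrow> N U = {0}) \<or> (\<forall>U. openin (mtop X) U \<longrightarrow> N U = sec M U))"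


section \<open>Regular holonomic modules\<close>

definition good_filtration :: "'x cmanifold \<Rightarrow> ('x, 'm::ab_group_add) dmodule \<Rightarrow> 'x set
    \<Rightarrow> (int \<Rightarrow> 'x set \<Rightarrow> 'm set) \<Rightarrow> bool" where
  "good_filtration X M U F \<longleftrightarrow>
     (\<forall>q. submodule_on X (ford X 0) M U (F q) \<and> coherent X (ford X 0) (M\<lparr>sec := F q\<rparr>) U) \<and>
     (\<forall>q V. openin (mtop X) V \<longrightarrow> V \<subseteq> U \<longrightarrow> F q V \<subseteq> F (q + 1) V) \<and>
     (\<forall>V m x. openin (mtop X) V \<longrightarrow> V \<subseteq> U \<longrightarrow> m \<in> sec M V \<longrightarrow> x \<in> V \<longrightarrow>
        (\<exists>W q. openin (mtop X) W \<and> x \<in> W \<and> W \<subseteq> V \<and> res M V W m \<in> F q W)) \<and>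
     (\<forall>x\<in>U. \<exists>V q0. openin (mtop X) V \<and> x \<in> V \<and> V \<subseteq> U \<and>
        (\<forall>q\<le>q0. \<forall>W. openin (mtop X) W \<longrightarrow> W \<subseteq> V \<longrightarrow> F q W = {0})) \<and>
     (\<forall>V p q P m. openin (mtop X) V \<longrightarrow> V \<subseteq> U \<longrightarrow> P \<in> ford X p V \<longrightarrow> m \<in> F q V \<longrightarrow>
        act M V P m \<in> F (q + int p) V) \<and>
     (\<forall>x\<in>U. \<exists>V q0. openin (mtop X) V \<and> x \<in> V \<and> V \<subseteq> U \<and>
        (\<forall>q\<ge>q0. \<forall>p W m y. openin (mtop X) W \<longrightarrow> W \<subseteq> V \<longrightarrow> m \<in> F (q + int p) W \<longrightarrow> y \<in> W \<longrightarrow>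
           (\<exists>W' r P n. openin (mtop X) W' \<and> y \<in> W' \<and> W' \<subseteq> W \<and>
              (\<forall>i<r. P i \<in> ford X p W' \<and> n i \<in> F q W') \<and>
              res M W W' m = (\<Sum>i<(r::nat). act M W' (P i) (n i)))))"

text \<open>The symbol of order p of P over V annihilates the graded module of F.\<close>

definition kills_gr :: "'x cmanifold \<Rightarrow> ('x, 'm::ab_group_add) dmodule
    \<Rightarrow> (int \<Rightarrow> 'x set \<Rightarrow> 'm set) \<Rightarrow> 'x set \<Rightarrow> nat \<Rightarrow> 'x dop \<Rightarrow> bool" where
  "kills_gr X M F V p P \<longleftrightarrow> (\<forall>W q m. openin (mtop X) W \<longrightarrow> W \<subseteq> V \<longrightarrow> m \<in> F q W \<longrightarrow>
     act M W (dres W P) m \<in> F (q + int p - 1) W)"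

text \<open>The characteristic variety over a chart: the pairs of a point x and the coordinates \<open>\<xi>\<close> of a
  cotangent vector at x at which all symbols annihilating the graded module (near x) of a good
  filtration vanish. It does not depend on the good filtration.\<close>

definition char_var :: "'x cmanifold \<Rightarrow> ('x, 'm::ab_group_add) dmodule \<Rightarrow> 'x chart
    \<Rightarrow> ('x \<times> (nat \<Rightarrow> complex)) set" where
  "char_var X M c = {(x, \<xi>). x \<in> fst c \<and> \<xi> \<in> cspace (mdim X) \<and>
     (\<exists>U F. openin (mtop X) U \<and> x \<in> U \<and> good_filtration X M U F \<and>
        (\<forall>V p P. openin (mtop X) V \<longrightarrow> x \<in> V \<longrightarrow> V \<subseteq> U \<longrightarrow> P \<in> ford X p V \<longrightarrow>
           kills_gr X M F V p P \<longrightarrow> symb X p P V c x \<xi> = 0))}"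

definition cot_coords :: "nat \<Rightarrow> 'x chart \<Rightarrow> 'x \<times> (nat \<Rightarrow> complex) \<Rightarrow> nat \<Rightarrow> complex" where
  "cot_coords n c = (\<lambda>(x, \<xi>) i. if i < n then snd c x i else \<xi> (i - n))"

definition contains_submanifold :: "nat \<Rightarrow> nat \<Rightarrow> (nat \<Rightarrow> complex) set \<Rightarrow> bool" where
  "contains_submanifold d N Z \<longleftrightarrow> (\<exists>W F. openin (top_of_set (cspace d)) W \<and> W \<noteq> {} \<and>
     (\<forall>i<N. holo d W (\<lambda>v. F v i)) \<and> immersive d N W F \<and> F ` W \<subseteq> Z)"

text \<open>The dimension of an analytic set is the maximal dimension of a manifold contained in it, as its
  regular points are dense.\<close>

definition char_dim :: "'x cmanifold \<Rightarrow> ('x, 'm::ab_group_add) dmodule \<Rightarrow> nat" where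
  "char_dim X M = Sup {d. \<exists>c\<in>charts X.
     contains_submanifold d (2 * mdim X) (cot_coords (mdim X) c ` char_var X M c)}"

definition holonomic :: "'x cmanifold \<Rightarrow> ('x, 'm::ab_group_add) dmodule \<Rightarrow> bool" where
  "holonomic X M \<longleftrightarrow> coherent X (diffops X) M (topspace (mtop X)) \<and>
     (zero_module X M \<or> char_dim X M = mdim X)"

text \<open>Regularity in the sense of Kashiwara--Kawai: locally there is a good filtration whose graded
  module is annihilated by all symbols that vanish on the characteristic variety.\<close>

definition regular_holonomic :: "'x cmanifold \<Rightarrow> ('x, 'm::ab_group_add) dmodule \<Rightarrow> bool" where
  "regular_holonomic X M \<longleftrightarrow> holonomic X M \<and>
     (\<forall>x\<in>topspace (mtop X). \<exists>U F. openin (mtop X) U \<and> x \<in> U \<and> good_filtration X M U F \<and>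
        (\<forall>V p P. openin (mtop X) V \<longrightarrow> V \<subseteq> U \<longrightarrow> P \<in> ford X p V \<longrightarrow>
           (\<forall>c\<in>charts X. \<forall>(y, \<xi>)\<in>char_var X M c. y \<in> V \<longrightarrow> symb X p P V c y \<xi> = 0) \<longrightarrow>
           kills_gr X M F V p P))"


section \<open>Localization\<close>

definition fmul :: "'x cmanifold \<Rightarrow> ('x, 'm) dmodule \<Rightarrow> 'x set \<Rightarrow> 'x lfun \<Rightarrow> 'm \<Rightarrow> 'm" where
  "fmul X M V g = act M V (mop X V (rs V g))"

text \<open>M, together with \<open>\<iota>\<close>, is the localization of S along f = 0: \<open>\<iota>\<close> is a morphism of D-modules
  that on stalks is the localization at the powers of f.\<close>

definition is_localization :: "'x cmanifold \<Rightarrow> 'x lfun \<Rightarrow> ('x, 's::ab_group_add) dmodule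
    \<Rightarrow> ('x, 'm::ab_group_add) dmodule \<Rightarrow> ('x set \<Rightarrow> 's \<Rightarrow> 'm) \<Rightarrow> bool" where
  "is_localization X f S M \<iota> \<longleftrightarrow> D_module X M \<and>
     (\<forall>V. openin (mtop X) V \<longrightarrow>
        bij_betw (fmul X M V f) (sec M V) (sec M V) \<and>
        (\<forall>u\<in>sec S V. \<iota> V u \<in> sec M V \<and>
           (\<forall>v\<in>sec S V. \<iota> V (u + v) = \<iota> V u + \<iota> V v) \<and>
           (\<forall>P\<in>diffops X V. \<iota> V (act S V P u) = act M V P (\<iota> V u)) \<and>
           (\<forall>W. openin (mtop X) W \<longrightarrow> W \<subseteq> V \<longrightarrow> \<iota> W (res S V W u) = res M V W (\<iota> V u)) \<and>
           (\<iota> V u = 0 \<longrightarrow> (\<forall>x\<in>V. \<exists>W k. openin (mtop X) W \<and> x \<in> W \<and> W \<subseteq> V \<and>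
              (fmul X S W f ^^ k) (res S V W u) = 0))) \<and>
        (\<forall>m\<in>sec M V. \<forall>x\<in>V. \<exists>W k. openin (mtop X) W \<and> x \<in> W \<and> W \<subseteq> V \<and>
           (\<exists>u\<in>sec S W. (fmul X M W f ^^ k) (res M V W m) = \<iota> W u)))"


section \<open>The module M[s] f^s\<close>

text \<open>A section of \<open>M[s] f^s\<close> over V is represented by the polynomial in s over the sections of M;
  multiplication by s is \<open>pCons 0\<close>, and \<open>m f^(s+k)\<close> is the constant polynomial \<open>[:f^k m:]\<close>.\<close>

definition psec :: "('x, 'm::zero) dmodule \<Rightarrow> 'x set \<Rightarrow> 'm poly set" where
  "psec M V = {u. \<forall>i. coeff u i \<in> sec M V}"

definition fdiv :: "'x cmanifold \<Rightarrow> 'x lfun \<Rightarrow> ('x, 'm) dmodule \<Rightarrow> 'x set \<Rightarrow> 'm \<Rightarrow> 'm" where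
  "fdiv X f M V = inv_into (sec M V) (fmul X M V f)"

text \<open>The pairs of a differential operator P over V and its action on \<open>M[s] f^s\<close>, as determined by
  the action of functions and the formula for vector fields. As \<open>dgen X V\<close> (the set of first
  components) coincides with the differential operators over small V, all operators are
  obtained locally.\<close>

inductive_set fs_ops :: "'x cmanifold \<Rightarrow> 'x lfun \<Rightarrow> ('x, 'm::ab_group_add) dmodule \<Rightarrow> 'x set
    \<Rightarrow> ('x dop \<times> ('m poly \<Rightarrow> 'm poly)) set" for X f M V where
  func: "g \<in> hol X V \<Longrightarrow> (mop X V g, map_poly (fmul X M V g)) \<in> fs_ops X f M V"
| vf: "\<xi> \<in> vfields X V \<Longrightarrow>
    (\<xi>, \<lambda>u. map_poly (act M V \<xi>) u
          + pCons 0 (map_poly (\<lambda>m. fdiv X f M V (fmul X M V (\<xi> V (rs V f)) m)) u))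
      \<in> fs_ops X f M V"
| add: "(P, S) \<in> fs_ops X f M V \<Longrightarrow> (Q, T) \<in> fs_ops X f M V \<Longrightarrow>
    (P + Q, \<lambda>u. S u + T u) \<in> fs_ops X f M V"
| comp: "(P, S) \<in> fs_ops X f M V \<Longrightarrow> (Q, T) \<in> fs_ops X f M V \<Longrightarrow>
    (dcomp P Q, S \<circ> T) \<in> fs_ops X f M V"

text \<open>All \<open>P \<cdot> u\<close> for \<open>P = P\<^sub>0 + P\<^sub>1 s + \<dots> + P\<^sub>N s\<^sup>N\<close> with differential operators \<open>P\<^sub>i\<close> over V.\<close>

definition Ds_image :: "'x cmanifold \<Rightarrow> 'x lfun \<Rightarrow> ('x, 'm::ab_group_add) dmodule \<Rightarrow> 'x set
    \<Rightarrow> 'm poly \<Rightarrow> 'm poly set" where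
  "Ds_image X f M V u = {v. \<exists>N P T. (\<forall>i\<le>N. (P i, T i) \<in> fs_ops X f M V) \<and>
     v = (\<Sum>i\<le>(N::nat). (pCons 0 ^^ i) (T i u))}"

definition pscale :: "'x cmanifold \<Rightarrow> ('x, 'm::ab_group_add) dmodule \<Rightarrow> 'x set
    \<Rightarrow> complex poly \<Rightarrow> 'm poly \<Rightarrow> 'm poly" where
  "pscale X M V b u =
     (\<Sum>i\<le>degree b. (pCons 0 ^^ i) (map_poly (fmul X M V (\<lambda>x. coeff b i)) u))"

text \<open>In the following m is a section of M over U. As usual for sheaves, an equation
  \<open>P \<cdot> u = v\<close> is solvable if this is so locally, i.e. if v is a section of the subsheaf generated
  by u. The \<open>b\<close>-function is set to 0, with multiplicity \<open>\<infinity>\<close> everywhere, if no non-zero polynomial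
  qualifies. For regular holonomic M this can happen only if U is not small: by Kashiwara's theorem
  every point has a neighbourhood over which a non-zero polynomial exists.\<close>

definition b_ideal :: "'x cmanifold \<Rightarrow> 'x lfun \<Rightarrow> ('x, 'm::ab_group_add) dmodule \<Rightarrow> 'x set \<Rightarrow> 'm
    \<Rightarrow> nat \<Rightarrow> complex poly set" where
  "b_ideal X f M U m k = {b. \<forall>x\<in>U. \<exists>V. openin (mtop X) V \<and> x \<in> V \<and> V \<subseteq> U \<and>
     pscale X M V b [:res M U V m:] \<in> Ds_image X f M V [:(fmul X M V f ^^ k) (res M U V m):]}"

definition b_function :: "'x cmanifold \<Rightarrow> 'x lfun \<Rightarrow> ('x, 'm::ab_group_add) dmodule \<Rightarrow> 'x set \<Rightarrow> 'm
    \<Rightarrow> nat \<Rightarrow> complex poly" where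
  "b_function X f M U m k =
     (if \<exists>b\<in>b_ideal X f M U m k. b \<noteq> 0
      then THE b. b \<in> b_ideal X f M U m k \<and> lead_coeff b = 1 \<and>
             (\<forall>c\<in>b_ideal X f M U m k. c \<noteq> 0 \<longrightarrow> degree b \<le> degree c)
      else 0)"

definition root_mult :: "complex \<Rightarrow> complex poly \<Rightarrow> enat" where
  "root_mult z b = (if b = 0 then \<infinity> else enat (order z b))"

definition nu :: "'x cmanifold \<Rightarrow> 'x lfun \<Rightarrow> ('x, 'm::ab_group_add) dmodule \<Rightarrow> 'x set \<Rightarrow> 'm
    \<Rightarrow> complex \<Rightarrow> enat" where
  "nu X f M U m \<alpha> = lim (\<lambda>k. root_mult (- \<alpha>) (b_function X f M U m k))"

definition ell :: "'x cmanifold \<Rightarrow> 'x lfun \<Rightarrow> ('x, 'm::ab_group_add) dmodule \<Rightarrow> 'x set \<Rightarrow> 'm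
    \<Rightarrow> complex \<Rightarrow> nat \<Rightarrow> enat" where
  "ell X f M U m \<alpha> k = Inf {enat l | l. \<forall>x\<in>U. \<exists>V. openin (mtop X) V \<and> x \<in> V \<and> V \<subseteq> U \<and>
     (\<exists>u\<in>psec M V.
        pscale X M V ([:\<alpha>, 1:] ^ l) [:res M U V m:] + pscale X M V ([:\<alpha>, 1:] ^ (l + 1)) u
          \<in> Ds_image X f M V [:(fmul X M V f ^^ k) (res M U V m):])}"

definition omega :: "'x cmanifold \<Rightarrow> 'x lfun \<Rightarrow> ('x, 'm::ab_group_add) dmodule \<Rightarrow> 'x set \<Rightarrow> 'm
    \<Rightarrow> complex \<Rightarrow> enat" where
  "omega X f M U m \<alpha> = lim (\<lambda>k. ell X f M U m \<alpha> k)"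

end

theory Submission
  imports Defs
begin

text \<open>Both invariants are suprema: the sequence \<open>\<ell>\<^sub>k\<close> and the sequence of multiplicities of \<open>-\<alpha>\<close> in the
  b-functions are non-decreasing in k, so it suffices to compare them for each k. If the b-function
  is \<open>b = (s + \<alpha>)^l q\<close> with \<open>q(-\<alpha>) \<noteq> 0\<close>, then dividing its functional equation by \<open>q(-\<alpha>)\<close> and
  reducing modulo \<open>(s + \<alpha>)^(l+1)\<close> leaves the equation that defines \<open>\<ell>\<^sub>k \<le> l\<close> (\<open>ell_le_order\<close>).

  Both sequences grow for the same reason: an operator P applied to \<open>m f^(s+k+1)\<close> is the operator
  P f applied to \<open>m f^(s+k)\<close>, so whatever is solvable for k + 1 is solvable for k
  (\<open>Ds_image_fmul_f\<close>). For \<open>\<ell>\<^sub>k\<close> this is the claim, since a minimum over fewer exponents is larger.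
  For the multiplicities it says that the (k+1)-st b-function satisfies the functional equation of
  the k-th, and one has to know that the k-th b-function then divides it. This holds because the
  polynomials with a functional equation form an ideal (\<open>b_ideal_add\<close>, \<open>b_ideal_mult\<close>), whose monic
  generator is the b-function (\<open>b_function_generates\<close>). Functional equations are only required
  locally, so adding two of them means restricting both to a common open set; the bulk of the
  work is the compatibility of the action of operators on \<open>M[s] f^s\<close> with restriction
  (\<open>fs_ops_res\<close>) and the \<open>\<complex>[s]\<close>-linearity of the solvable right-hand sides (\<open>Ds_image_pscale\<close>).

  The values \<open>\<infinity>\<close> fit in: if no non-zero polynomial has a functional equation for k, the
  multiplicity is \<open>\<infinity>\<close> for k and for all larger exponents, and monotone sequences of extended
  natural numbers converge to their suprema whether or not these are finite.\<close>

section \<open>Holomorphic functions on a manifold\<close>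

lemma holo_partial:
  "holo n W h \<Longrightarrow> v \<in> W \<Longrightarrow> i < n \<Longrightarrow> (\<lambda>z. h (v(i := z))) field_differentiable (at (v i))"
  unfolding holo_def by simp

lemma chart_image_open:
  assumes "complex_manifold X" "(C, \<phi>) \<in> charts X" "openin (mtop X) W"
  shows "openin (top_of_set (cspace (mdim X))) (\<phi> ` (C \<inter> W))" and "inj_on \<phi> C"
proof -
  have C: "openin (mtop X) C" "openin (top_of_set (cspace (mdim X))) (\<phi> ` C)"
      "homeomorphic_map (subtopology (mtop X) C) (top_of_set (\<phi> ` C)) \<phi>"
    using assms(1,2) unfolding complex_manifold_def by blast+
  have top: "topspace (subtopology (mtop X) C) = C"
    using C(1) by (simp add: openin_subset topspace_subtopology_subset del: topspace_subtopology)
  show "inj_on \<phi> C"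
    using C(3) top homeomorphic_imp_injective_map by fastforce
  have "openin (subtopology (mtop X) C) (C \<inter> W)"
    using assms(3) by (metis inf_commute openin_subtopology)
  then have "openin (top_of_set (\<phi> ` C)) (\<phi> ` (C \<inter> W))"
    using homeomorphic_imp_open_map[OF C(3)] unfolding open_map_def by blast
  then show "openin (top_of_set (cspace (mdim X))) (\<phi> ` (C \<inter> W))"
    using C(2) openin_trans by blast
qed

text \<open>Holomorphy is local: near a point of W, varying one coordinate does not leave W, because the
  image of W in a chart is open in the coordinate space. For \<open>g = rs W h\<close> this says that cutting off
  preserves holomorphy.\<close>

lemma holo_chart_cong:
  assumes X: "complex_manifold X" "(C, \<phi>) \<in> charts X" and W: "openin (mtop X) W" "W \<subseteq> V"
    and h: "holo (mdim X) (\<phi> ` (C \<inter> V)) (\<lambda>v. h (inv_into C \<phi> v))"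
    and eq: "\<And>x. x \<in> W \<Longrightarrow> g x = h x"
  shows "holo (mdim X) (\<phi> ` (C \<inter> W)) (\<lambda>v. g (inv_into C \<phi> v))"
proof -
  let ?n = "mdim X" and ?W = "\<phi> ` (C \<inter> W)"
  note op = chart_image_open(1)[OF X W(1)] and inj = chart_image_open(2)[OF X W(1)]
  obtain T where T: "open T" "?W = cspace ?n \<inter> T"
    using op unfolding openin_open by blast
  have gh: "g (inv_into C \<phi> v) = h (inv_into C \<phi> v)" if "v \<in> ?W" for v
    using that eq inj by auto
  have sub: "?W \<subseteq> \<phi> ` (C \<inter> V)" using W(2) by blast
  have "continuous_on ?W (\<lambda>v. h (inv_into C \<phi> v))"
    using h sub continuous_on_subset unfolding holo_def by blast
  then have "continuous_on ?W (\<lambda>v. g (inv_into C \<phi> v))"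
    using gh by (simp cong: continuous_on_cong)
  moreover have "(\<lambda>z. g (inv_into C \<phi> (v(i := z)))) field_differentiable (at (v i))"
    if v: "v \<in> ?W" and i: "i < ?n" for v i
  proof -
    let ?u = "\<lambda>z. v(i := z)"
    have "continuous_on UNIV ?u"
    proof (rule continuous_on_coordinatewise_then_product)
      show "continuous_on UNIV (\<lambda>z. ?u z j)" for j by (cases "j = i") simp_all
    qed
    then have opn: "open (?u -` T)" using T(1) open_vimage by blast
    have vi: "v i \<in> ?u -` T" using v T(2) by auto
    have "?u z \<in> ?W" if "z \<in> ?u -` T" for z
      using that v i unfolding T(2) cspace_def by auto
    then have gh_near: "h (inv_into C \<phi> (?u z)) = g (inv_into C \<phi> (?u z))" if "z \<in> ?u -` T" for z
      using that gh by metis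
    have "v \<in> \<phi> ` (C \<inter> V)" using v sub by (rule subsetD[rotated])
    note holo_partial[OF h this i]
    then obtain D where "((\<lambda>z. h (inv_into C \<phi> (?u z))) has_field_derivative D) (at (v i))"
      unfolding field_differentiable_def by (rule exE)
    from has_field_derivative_transform_within_open[OF this opn vi gh_near]
    show ?thesis unfolding field_differentiable_def by (rule exI)
  qed
  ultimately show ?thesis unfolding holo_def by blast
qed

lemma holo_const: "holo n W (\<lambda>v. c)"
  unfolding holo_def by auto

lemma holo_mult: "holo n W g \<Longrightarrow> holo n W h \<Longrightarrow> holo n W (\<lambda>v. g v * h v)"
  unfolding holo_def by (auto intro: continuous_on_mult field_differentiable_mult)

lemma holo_add: "holo n W g \<Longrightarrow> holo n W h \<Longrightarrow> holo n W (\<lambda>v. g v + h v)"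
  unfolding holo_def by (auto intro: continuous_on_add field_differentiable_add)

lemma rs_rs: "W \<subseteq> V \<Longrightarrow> rs W (rs V g) = rs W g"
  unfolding rs_def by (auto simp: fun_eq_iff)

lemma rs_hol: "g \<in> hol X V \<Longrightarrow> rs V g = g"
  unfolding rs_def hol_def by auto

lemma hol_const:
  assumes "complex_manifold X" "openin (mtop X) V"
  shows "rs V (\<lambda>x. c) \<in> hol X V"
  using holo_chart_cong[OF assms(1) _ assms(2) subset_refl holo_const[of _ _ c],
      where g = "rs V (\<lambda>x. c)"]
  unfolding hol_def by (auto simp: rs_def)

lemma hol_rs:
  assumes "complex_manifold X" "openin (mtop X) W" "W \<subseteq> V" "g \<in> hol X V"
  shows "rs W g \<in> hol X W"
  using holo_chart_cong[OF assms(1) _ assms(2,3), where g = "rs W g" and h = g] assms(4)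
  unfolding hol_def by (auto simp: rs_def)

lemma hol_mult: "g \<in> hol X V \<Longrightarrow> h \<in> hol X V \<Longrightarrow> g * h \<in> hol X V"
  unfolding hol_def by (auto intro!: holo_mult)

lemma hol_add: "g \<in> hol X V \<Longrightarrow> h \<in> hol X V \<Longrightarrow> g + h \<in> hol X V"
  unfolding hol_def by (auto intro!: holo_add)

lemma hol_scale:
  assumes "complex_manifold X" "openin (mtop X) V" "g \<in> hol X V"
  shows "(\<lambda>x. c * g x) \<in> hol X V"
proof -
  have "(\<lambda>x. c * g x) = rs V (\<lambda>x. c) * g"
    using assms(3) by (auto simp: rs_def hol_def fun_eq_iff)
  then show ?thesis using hol_mult[OF hol_const[OF assms(1,2)] assms(3)] by simp
qed


section \<open>Functions and vector fields as differential operators\<close>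

lemma mop_in_sheaf_end:
  assumes X: "complex_manifold X" and V: "openin (mtop X) V" and g: "g \<in> hol X V"
  shows "mop X V g \<in> sheaf_end X V"
proof -
  have *: "g * h \<in> hol X W" if "openin (mtop X) W" "W \<subseteq> V" "h \<in> hol X W" for W h
  proof -
    have "g * h = rs W g * h"
      using that(3) by (auto simp: rs_def hol_def fun_eq_iff)
    then show ?thesis using hol_mult[OF hol_rs[OF X that(1,2) g] that(3)] by simp
  qed
  have eq: "mop X V g W h = g * h" if "openin (mtop X) W" "W \<subseteq> V" "h \<in> hol X W" for W h
    using that by (simp add: mop_def)
  have zero: "mop X V g W h = 0" if "\<not> (openin (mtop X) W \<and> W \<subseteq> V \<and> h \<in> hol X W)" for W h
    using that by (auto simp: mop_def)
  have scale: "mop X V g W (\<lambda>x. c * h x) = (\<lambda>x. c * mop X V g W h x)"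
    if "openin (mtop X) W" "W \<subseteq> V" "h \<in> hol X W" for W h c
    using that by (simp add: eq hol_scale[OF X] fun_eq_iff)
  have plus: "mop X V g W (h + h') = mop X V g W h + mop X V g W h'"
    if "openin (mtop X) W" "W \<subseteq> V" "h \<in> hol X W" "h' \<in> hol X W" for W h h'
    using that by (simp add: eq hol_add distrib_left)
  have restr: "mop X V g W' (rs W' h) = rs W' (mop X V g W h)"
    if "openin (mtop X) W" "W \<subseteq> V" "h \<in> hol X W" "openin (mtop X) W'" "W' \<subseteq> W" for W W' h
  proof -
    have "W' \<subseteq> V" using that by blast
    then have "mop X V g W' (rs W' h) = g * rs W' h"
      using eq hol_rs[OF X that(4,5,3)] that(4) by blast
    also have "\<dots> = rs W' (g * h)" by (auto simp: rs_def)
    finally show ?thesis using that by (simp add: eq)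
  qed
  have mem: "mop X V g W h \<in> hol X W" if "openin (mtop X) W" "W \<subseteq> V" "h \<in> hol X W" for W h
    using that * by (simp add: eq)
  show ?thesis
    unfolding sheaf_end_def
    by (intro CollectI conjI allI impI ballI; rule zero mem scale plus restr; assumption)
qed

lemma dres_sheaf_end: "P \<in> sheaf_end X V \<Longrightarrow> dres V P = P"
  unfolding sheaf_end_def dres_def by (auto simp: fun_eq_iff)

lemma dgen_diffops:
  assumes "openin (mtop X) V" "P \<in> sheaf_end X V" "P \<in> dgen X V"
  shows "P \<in> diffops X V"
  unfolding diffops_def using assms dres_sheaf_end by fastforce

lemma mop_diffops:
  assumes "complex_manifold X" "openin (mtop X) V" "g \<in> hol X V"
  shows "mop X V g \<in> diffops X V"
  using assms by (intro dgen_diffops mop_in_sheaf_end dgen.func)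

lemma vfields_diffops:
  assumes "openin (mtop X) V" "\<xi> \<in> vfields X V"
  shows "\<xi> \<in> diffops X V"
  using assms by (intro dgen_diffops dgen.vf) (auto simp: vfields_def)

text \<open>Restriction of an operator only forgets components, but the values on open sets outside W become
  zero, so the normalisation has to be checked along with the sheaf axioms.\<close>

lemma dres_in_sheaf_end:
  assumes "W \<subseteq> V" "P \<in> sheaf_end X V"
  shows "dres W P \<in> sheaf_end X W"
proof -
  have zero: "P W' g = 0" if "\<not> (openin (mtop X) W' \<and> W' \<subseteq> V \<and> g \<in> hol X W')" for W' g
    using assms(2) that unfolding sheaf_end_def by simp
  have P: "P W' g \<in> hol X W' \<and> (\<forall>c. P W' (\<lambda>x. c * g x) = (\<lambda>x. c * P W' g x)) \<and>
      (\<forall>h\<in>hol X W'. P W' (g + h) = P W' g + P W' h) \<and>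
      (\<forall>W''. openin (mtop X) W'' \<longrightarrow> W'' \<subseteq> W' \<longrightarrow> P W'' (rs W'' g) = rs W'' (P W' g))"
    if "openin (mtop X) W'" "W' \<subseteq> V" "g \<in> hol X W'" for W' g
    using assms(2) that unfolding sheaf_end_def by simp
  have eq: "dres W P W' = P W'" if "W' \<subseteq> W" for W'
    using that by (auto simp: dres_def fun_eq_iff)
  show ?thesis
    unfolding sheaf_end_def
  proof (rule CollectI, intro conjI allI impI)
    fix W' g assume "\<not> (openin (mtop X) W' \<and> W' \<subseteq> W \<and> g \<in> hol X W')"
    then show "dres W P W' g = 0" using zero[of W' g] by (auto simp: dres_def)
  next
    fix W' assume W': "openin (mtop X) W'" "W' \<subseteq> W"
    have sub: "W'' \<subseteq> W" if "W'' \<subseteq> W'" for W'' using that W'(2) by (rule subset_trans)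
    have "W' \<subseteq> V" using W'(2) assms(1) by (rule subset_trans)
    then show "\<forall>g\<in>hol X W'. dres W P W' g \<in> hol X W' \<and>
      (\<forall>c. dres W P W' (\<lambda>x. c * g x) = (\<lambda>x. c * dres W P W' g x)) \<and>
      (\<forall>h\<in>hol X W'. dres W P W' (g + h) = dres W P W' g + dres W P W' h) \<and>
      (\<forall>W''. openin (mtop X) W'' \<longrightarrow> W'' \<subseteq> W' \<longrightarrow> dres W P W'' (rs W'' g) = rs W'' (dres W P W' g))"
      using P[OF W'(1)] W'(2) by (simp add: eq sub)
  qed
qed

lemma dres_vfields:
  assumes "W \<subseteq> V" "\<xi> \<in> vfields X V"
  shows "dres W \<xi> \<in> vfields X W"
proof -
  have leibniz: "\<xi> W' (g * h) = \<xi> W' g * h + g * \<xi> W' h"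
    if "openin (mtop X) W'" "W' \<subseteq> W" "g \<in> hol X W'" "h \<in> hol X W'" for W' g h
    using assms(2) that subset_trans[OF that(2) assms(1)] unfolding vfields_def by simp
  have "\<xi> \<in> sheaf_end X V" using assms(2) unfolding vfields_def by simp
  then show ?thesis
    using dres_in_sheaf_end[OF assms(1)] leibniz unfolding vfields_def by (simp add: dres_def)
qed

lemma dres_mop:
  assumes "W \<subseteq> V"
  shows "dres W (mop X V g) = mop X W (rs W g)"
  using assms unfolding dres_def mop_def hol_def rs_def by (auto simp: fun_eq_iff)


section \<open>Modules over the ring of polynomials in s\<close>

lemma pCons_sum: "pCons 0 (sum g A) = (\<Sum>i\<in>A. pCons 0 (g i :: 'm::ab_group_add poly))"
  using sum_comp_morphism[of "pCons 0" g A] by (simp add: o_def)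

lemma shift_zero: "(pCons 0 ^^ n) 0 = (0 :: 'm::ab_group_add poly)"
  by (induction n) simp_all

lemma shift_add: "(pCons 0 ^^ n) (u + v) = (pCons 0 ^^ n) u + (pCons 0 ^^ n) (v :: 'm::ab_group_add poly)"
  by (induction n) simp_all

text \<open>What the proof needs to know about the localization: it is a D-module on which f acts
  bijectively.\<close>

locale localized_module =
  fixes X :: "'x cmanifold" and f :: "'x \<Rightarrow> complex" and M :: "('x, 'm::ab_group_add) dmodule"
  assumes manifold: "complex_manifold X"
    and hol_f: "f \<in> hol X (topspace (mtop X))"
    and D_module: "D_module X M"
    and bij_f: "\<And>V. openin (mtop X) V \<Longrightarrow> bij_betw (fmul X M V f) (sec M V) (sec M V)"
begin

abbreviation opn :: "'x set \<Rightarrow> bool" where "opn \<equiv> openin (mtop X)"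

lemma sec_group: "opn V \<Longrightarrow> 0 \<in> sec M V \<and>
    (\<forall>a\<in>sec M V. - a \<in> sec M V \<and> res M V V a = a \<and> (\<forall>b\<in>sec M V. a + b \<in> sec M V))"
  using D_module[unfolded D_module_def sheaf_def, THEN conjunct1, THEN conjunct1, rule_format] .

lemma sec_zero: "opn V \<Longrightarrow> 0 \<in> sec M V"
  and sec_add: "opn V \<Longrightarrow> a \<in> sec M V \<Longrightarrow> b \<in> sec M V \<Longrightarrow> a + b \<in> sec M V"
  using sec_group by simp_all

lemma sec_restriction:
  assumes "opn V" "opn W" "W \<subseteq> V" "a \<in> sec M V"
  shows "res M V W a \<in> sec M W \<and>
    (\<forall>b\<in>sec M V. res M V W (a + b) = res M V W a + res M V W b) \<and>
    (\<forall>W'. opn W' \<longrightarrow> W' \<subseteq> W \<longrightarrow> res M W W' (res M V W a) = res M V W' a)"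
  using D_module[unfolded D_module_def sheaf_def, THEN conjunct1, THEN conjunct2, THEN conjunct1,
      THEN spec, THEN spec, THEN mp, THEN mp, THEN mp, THEN bspec, OF assms] .

lemma res_sec: "opn V \<Longrightarrow> opn W \<Longrightarrow> W \<subseteq> V \<Longrightarrow> a \<in> sec M V \<Longrightarrow> res M V W a \<in> sec M W"
  and res_add: "opn V \<Longrightarrow> opn W \<Longrightarrow> W \<subseteq> V \<Longrightarrow> a \<in> sec M V \<Longrightarrow> b \<in> sec M V \<Longrightarrow>
    res M V W (a + b) = res M V W a + res M V W b"
  and res_res: "opn V \<Longrightarrow> opn W \<Longrightarrow> opn W' \<Longrightarrow> W \<subseteq> V \<Longrightarrow> W' \<subseteq> W \<Longrightarrow> a \<in> sec M V \<Longrightarrow>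
    res M W W' (res M V W a) = res M V W' a"
  using sec_restriction by simp_all

lemma sec_action:
  assumes "opn V" "a \<in> sec M V"
  shows "act M V (mop X V (rs V (\<lambda>x. 1))) a = a \<and>
    (\<forall>P\<in>diffops X V. act M V P a \<in> sec M V \<and>
      (\<forall>b\<in>sec M V. act M V P (a + b) = act M V P a + act M V P b) \<and>
      (\<forall>Q\<in>diffops X V. act M V (P + Q) a = act M V P a + act M V Q a \<and>
        act M V (dcomp P Q) a = act M V P (act M V Q a)) \<and>
      (\<forall>W. opn W \<longrightarrow> W \<subseteq> V \<longrightarrow> res M V W (act M V P a) = act M W (dres W P) (res M V W a)))"
  using D_module[unfolded D_module_def, THEN conjunct2, THEN spec, THEN mp, THEN bspec, OF assms] .

lemma act_sec: "opn V \<Longrightarrow> P \<in> diffops X V \<Longrightarrow> a \<in> sec M V \<Longrightarrow> act M V P a \<in> sec M V"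
  and act_add: "opn V \<Longrightarrow> P \<in> diffops X V \<Longrightarrow> a \<in> sec M V \<Longrightarrow> b \<in> sec M V \<Longrightarrow>
    act M V P (a + b) = act M V P a + act M V P b"
  and act_plus: "opn V \<Longrightarrow> P \<in> diffops X V \<Longrightarrow> Q \<in> diffops X V \<Longrightarrow> a \<in> sec M V \<Longrightarrow>
    act M V (P + Q) a = act M V P a + act M V Q a"
  and act_dcomp: "opn V \<Longrightarrow> P \<in> diffops X V \<Longrightarrow> Q \<in> diffops X V \<Longrightarrow> a \<in> sec M V \<Longrightarrow>
    act M V (dcomp P Q) a = act M V P (act M V Q a)"
  and res_act: "opn V \<Longrightarrow> opn W \<Longrightarrow> W \<subseteq> V \<Longrightarrow> P \<in> diffops X V \<Longrightarrow> a \<in> sec M V \<Longrightarrow>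
    res M V W (act M V P a) = act M W (dres W P) (res M V W a)"
  using sec_action by simp_all

lemma act_zero: "opn V \<Longrightarrow> P \<in> diffops X V \<Longrightarrow> act M V P 0 = 0"
  using act_add[of V P 0 0] sec_zero[of V] by simp

lemma res_zero: "opn V \<Longrightarrow> opn W \<Longrightarrow> W \<subseteq> V \<Longrightarrow> res M V W 0 = 0"
  using res_add[of V W 0 0] sec_zero[of V] by simp

lemma fmul_rs: "fmul X M V (rs V g) = fmul X M V g"
  unfolding fmul_def by (simp add: rs_rs)

lemma mop_rs_diffops: "opn V \<Longrightarrow> rs V g \<in> hol X V \<Longrightarrow> mop X V (rs V g) \<in> diffops X V"
  using mop_diffops[OF manifold] .

lemma fmul_sec: "opn V \<Longrightarrow> rs V g \<in> hol X V \<Longrightarrow> a \<in> sec M V \<Longrightarrow> fmul X M V g a \<in> sec M V"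
  and fmul_add: "opn V \<Longrightarrow> rs V g \<in> hol X V \<Longrightarrow> a \<in> sec M V \<Longrightarrow> b \<in> sec M V \<Longrightarrow>
    fmul X M V g (a + b) = fmul X M V g a + fmul X M V g b"
  and fmul_zero: "opn V \<Longrightarrow> rs V g \<in> hol X V \<Longrightarrow> fmul X M V g 0 = 0"
  unfolding fmul_def by (simp_all add: act_sec act_add act_zero mop_rs_diffops)

lemma res_fmul:
  assumes "opn V" "opn W" "W \<subseteq> V" "rs V g \<in> hol X V" "a \<in> sec M V"
  shows "res M V W (fmul X M V g a) = fmul X M W g (res M V W a)"
  using assms unfolding fmul_def by (simp add: res_act mop_rs_diffops dres_mop rs_rs)

lemma rs_f: "opn V \<Longrightarrow> rs V f \<in> hol X V"
  using hol_rs[OF manifold _ _ hol_f] by (simp add: openin_subset)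

lemma rs_const: "opn V \<Longrightarrow> rs V (\<lambda>x. c) \<in> hol X V"
  by (rule hol_const[OF manifold])

lemma fmul_const_plus:
  assumes "opn V" "a \<in> sec M V"
  shows "fmul X M V (\<lambda>x. c + d) a = fmul X M V (\<lambda>x. c) a + fmul X M V (\<lambda>x. d) a"
proof -
  have "mop X V (rs V (\<lambda>x. c + d)) = mop X V (rs V (\<lambda>x. c)) + mop X V (rs V (\<lambda>x. d))"
    by (auto simp: mop_def rs_def fun_eq_iff algebra_simps)
  then show ?thesis
    unfolding fmul_def using assms by (simp add: act_plus mop_rs_diffops rs_const)
qed

lemma fmul_const_mult:
  assumes "opn V" "a \<in> sec M V"
  shows "fmul X M V (\<lambda>x. c * d) a = fmul X M V (\<lambda>x. c) (fmul X M V (\<lambda>x. d) a)"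
proof -
  have "rs V (\<lambda>x. d) * h \<in> hol X W" if "opn W" "W \<subseteq> V" "h \<in> hol X W" for W h
  proof -
    have "rs V (\<lambda>x. d) * h = (\<lambda>x. d * h x)"
      using that by (auto simp: rs_def hol_def fun_eq_iff)
    then show ?thesis using hol_scale[OF manifold that(1,3)] by simp
  qed
  then have "mop X V (rs V (\<lambda>x. c * d)) = dcomp (mop X V (rs V (\<lambda>x. c))) (mop X V (rs V (\<lambda>x. d)))"
    by (auto simp: mop_def dcomp_def rs_def fun_eq_iff)
  then show ?thesis
    unfolding fmul_def using assms by (simp add: act_dcomp mop_rs_diffops rs_const)
qed

lemma fmul_const_zero:
  assumes "opn V" "a \<in> sec M V"
  shows "fmul X M V (\<lambda>x. 0) a = 0"
  using fmul_const_plus[OF assms, of 0 0] by simp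

lemma fdiv_sec: "opn V \<Longrightarrow> a \<in> sec M V \<Longrightarrow> fdiv X f M V a \<in> sec M V"
  and fmul_fdiv: "opn V \<Longrightarrow> a \<in> sec M V \<Longrightarrow> fmul X M V f (fdiv X f M V a) = a"
  using bij_f[of V] unfolding fdiv_def bij_betw_def
  by (auto intro: inv_into_into f_inv_into_f)

lemma fdiv_fmul: "opn V \<Longrightarrow> a \<in> sec M V \<Longrightarrow> fdiv X f M V (fmul X M V f a) = a"
  using bij_f[of V] unfolding fdiv_def bij_betw_def by auto

lemma fdiv_zero: "opn V \<Longrightarrow> fdiv X f M V 0 = 0"
  using fdiv_fmul[of V 0] by (simp add: fmul_zero rs_f sec_zero)

text \<open>Division by f is determined by multiplication by f, which commutes with restriction.\<close>

lemma res_fdiv: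
  assumes "opn V" "opn W" "W \<subseteq> V" "a \<in> sec M V"
  shows "res M V W (fdiv X f M V a) = fdiv X f M W (res M V W a)"
proof -
  have "fmul X M W f (res M V W (fdiv X f M V a)) = res M V W a"
    using assms by (simp flip: res_fmul add: rs_f fdiv_sec fmul_fdiv)
  then show ?thesis
    using assms by (metis fdiv_fmul fdiv_sec res_sec)
qed

lemma fmul_f_power_sec: "opn V \<Longrightarrow> a \<in> sec M V \<Longrightarrow> (fmul X M V f ^^ k) a \<in> sec M V"
  by (induction k) (simp_all add: fmul_sec rs_f)

lemma res_fmul_f_power:
  assumes "opn V" "opn W" "W \<subseteq> V" "a \<in> sec M V"
  shows "res M V W ((fmul X M V f ^^ k) a) = (fmul X M W f ^^ k) (res M V W a)"
  using assms by (induction k) (simp_all add: res_fmul rs_f fmul_f_power_sec)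


subsection \<open>The action of polynomials in s\<close>

lemma psec_zero: "opn V \<Longrightarrow> 0 \<in> psec M V"
  and psec_add: "opn V \<Longrightarrow> u \<in> psec M V \<Longrightarrow> v \<in> psec M V \<Longrightarrow> u + v \<in> psec M V"
  unfolding psec_def by (simp_all add: sec_zero sec_add)

lemma psec_pCons: "a \<in> sec M V \<Longrightarrow> u \<in> psec M V \<Longrightarrow> pCons a u \<in> psec M V"
  unfolding psec_def by (auto simp: coeff_pCons split: nat.split)

lemma psec_shift: "opn V \<Longrightarrow> u \<in> psec M V \<Longrightarrow> (pCons 0 ^^ n) u \<in> psec M V"
  by (induction n) (simp_all add: psec_pCons sec_zero)

lemma psec_sum: "opn V \<Longrightarrow> (\<And>i. i \<in> A \<Longrightarrow> g i \<in> psec M V) \<Longrightarrow> sum g A \<in> psec M V"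
  by (induction A rule: infinite_finite_induct) (simp_all add: psec_zero psec_add)

lemma psec_map_poly: "t 0 = 0 \<Longrightarrow> (\<And>a. a \<in> sec M V \<Longrightarrow> t a \<in> sec M W) \<Longrightarrow> u \<in> psec M V \<Longrightarrow>
    map_poly t u \<in> psec M W"
  unfolding psec_def by (simp add: coeff_map_poly)

lemma map_poly_pCons_zero: "t 0 = 0 \<Longrightarrow> map_poly t (pCons a u) = pCons (t a) (map_poly t u)"
  by (intro poly_eqI) (simp add: coeff_map_poly coeff_pCons split: nat.split)

lemma map_poly_shift: "t 0 = 0 \<Longrightarrow> map_poly t ((pCons 0 ^^ n) u) = (pCons 0 ^^ n) (map_poly t u)"
  by (induction n) (simp_all add: map_poly_pCons_zero)

lemma map_poly_add_psec:
  assumes "t 0 = 0" "\<And>a b. a \<in> sec M V \<Longrightarrow> b \<in> sec M V \<Longrightarrow> t (a + b) = t a + t b"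
    and "u \<in> psec M V" "v \<in> psec M V"
  shows "map_poly t (u + v) = map_poly t u + map_poly t v"
  using assms unfolding psec_def by (intro poly_eqI) (simp add: coeff_map_poly)

lemma map_poly_sum_psec:
  assumes "opn V" "t 0 = 0" "\<And>a b. a \<in> sec M V \<Longrightarrow> b \<in> sec M V \<Longrightarrow> t (a + b) = t a + t b"
    and "\<And>i. i \<in> A \<Longrightarrow> g i \<in> psec M V"
  shows "map_poly t (sum g A) = (\<Sum>i\<in>A. map_poly t (g i))"
  using assms(4)
  by (induction A rule: infinite_finite_induct)
    (simp_all add: map_poly_add_psec[of t V, OF assms(2,3)] psec_sum assms(1))

definition cscale :: "'x set \<Rightarrow> complex \<Rightarrow> 'm poly \<Rightarrow> 'm poly" where
  "cscale V c = map_poly (fmul X M V (\<lambda>x. c))"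

lemma coeff_cscale: "opn V \<Longrightarrow> coeff (cscale V c u) i = fmul X M V (\<lambda>x. c) (coeff u i)"
  unfolding cscale_def by (simp add: coeff_map_poly fmul_zero rs_const)

lemma cscale_zero_right: "cscale V c 0 = 0"
  unfolding cscale_def by simp

lemma cscale_psec: "opn V \<Longrightarrow> u \<in> psec M V \<Longrightarrow> cscale V c u \<in> psec M V"
  unfolding psec_def by (simp add: coeff_cscale fmul_sec rs_const)

lemma cscale_add: "opn V \<Longrightarrow> u \<in> psec M V \<Longrightarrow> v \<in> psec M V \<Longrightarrow>
    cscale V c (u + v) = cscale V c u + cscale V c v"
  and cscale_plus: "opn V \<Longrightarrow> u \<in> psec M V \<Longrightarrow> cscale V (c + d) u = cscale V c u + cscale V d u"
  and cscale_mult: "opn V \<Longrightarrow> u \<in> psec M V \<Longrightarrow> cscale V (c * d) u = cscale V c (cscale V d u)"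
  and cscale_zero: "opn V \<Longrightarrow> u \<in> psec M V \<Longrightarrow> cscale V 0 u = 0"
  and cscale_pCons0: "opn V \<Longrightarrow> cscale V c (pCons 0 u) = pCons 0 (cscale V c u)"
  unfolding psec_def
  by (intro poly_eqI; simp add: coeff_cscale coeff_pCons fmul_add fmul_const_plus fmul_const_mult
      fmul_const_zero fmul_zero rs_const split: nat.split)+

lemma pscale_alt:
  assumes "opn V" "u \<in> psec M V" "degree b \<le> N"
  shows "pscale X M V b u = (\<Sum>i\<le>N. (pCons 0 ^^ i) (cscale V (coeff b i) u))"
  unfolding pscale_def cscale_def[symmetric]
proof (rule sum.mono_neutral_left)
  show "\<forall>i\<in>{..N} - {..degree b}. (pCons 0 ^^ i) (cscale V (coeff b i) u) = 0"
    using assms by (auto simp: coeff_eq_0 cscale_zero shift_zero)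
qed (use assms in auto)

lemma pscale_zero: "opn V \<Longrightarrow> u \<in> psec M V \<Longrightarrow> pscale X M V 0 u = 0"
  by (simp add: pscale_alt[of V u 0 0] cscale_zero)

text \<open>Horner's rule; all algebraic properties of the action of the polynomials in s follow from it
  by induction on the polynomial.\<close>

lemma pscale_pCons:
  assumes "opn V" "u \<in> psec M V"
  shows "pscale X M V (pCons a b) u = cscale V a u + pCons 0 (pscale X M V b u)"
proof -
  have "pscale X M V (pCons a b) u
      = (\<Sum>i\<le>Suc (degree b). (pCons 0 ^^ i) (cscale V (coeff (pCons a b) i) u))"
    using assms by (intro pscale_alt) (auto simp: degree_pCons_le)
  also have "\<dots> = cscale V a u
      + pCons 0 (\<Sum>i\<le>degree b. (pCons 0 ^^ i) (cscale V (coeff b i) u))"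
    by (simp only: sum.atMost_Suc_shift pCons_sum) simp
  finally show ?thesis using assms by (simp add: pscale_alt[of V u b "degree b"])
qed

lemma pscale_psec: "opn V \<Longrightarrow> u \<in> psec M V \<Longrightarrow> pscale X M V b u \<in> psec M V"
  by (induction b) (simp_all add: pscale_zero psec_zero pscale_pCons psec_add cscale_psec
      psec_pCons sec_zero)

lemma pscale_plus:
  assumes "opn V" "u \<in> psec M V"
  shows "pscale X M V (b + c) u = pscale X M V b u + pscale X M V c u"
proof (induction b arbitrary: c)
  case (pCons a b)
  obtain d e where c: "c = pCons d e" by (cases c) auto
  have "pscale X M V (pCons a b + c) u
      = cscale V a u + cscale V d u + pCons 0 (pscale X M V b u + pscale X M V e u)"
    using assms pCons.IH[of e] by (simp add: c pscale_pCons cscale_plus)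
  also have "pCons 0 (pscale X M V b u + pscale X M V e u)
      = pCons 0 (pscale X M V b u) + pCons 0 (pscale X M V e u)"
    by simp
  finally show ?case
    using assms by (simp only: c pscale_pCons ac_simps)
qed (use assms in \<open>simp add: pscale_zero\<close>)

lemma cscale_pscale:
  assumes "opn V" "u \<in> psec M V"
  shows "pscale X M V (smult c b) u = cscale V c (pscale X M V b u)"
  using assms
  by (induction b) (simp_all add: pscale_zero pscale_pCons cscale_add cscale_psec psec_pCons sec_zero
      pscale_psec cscale_mult cscale_pCons0 cscale_zero_right)

lemma pscale_mult:
  assumes "opn V" "u \<in> psec M V"
  shows "pscale X M V (b * c) u = pscale X M V b (pscale X M V c u)"
  using assms by (induction b)
    (simp_all add: pscale_zero pscale_psec pscale_pCons pscale_plus cscale_pscale cscale_zero psec_zero)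

lemma res_psec: "opn V \<Longrightarrow> opn W \<Longrightarrow> W \<subseteq> V \<Longrightarrow> u \<in> psec M V \<Longrightarrow> map_poly (res M V W) u \<in> psec M W"
  by (rule psec_map_poly) (simp_all add: res_zero res_sec)

lemma res_padd: "opn V \<Longrightarrow> opn W \<Longrightarrow> W \<subseteq> V \<Longrightarrow> u \<in> psec M V \<Longrightarrow> v \<in> psec M V \<Longrightarrow>
    map_poly (res M V W) (u + v) = map_poly (res M V W) u + map_poly (res M V W) v"
  by (rule map_poly_add_psec) (simp_all add: res_zero res_add)

lemma res_cscale:
  assumes "opn V" "opn W" "W \<subseteq> V" "u \<in> psec M V"
  shows "map_poly (res M V W) (cscale V c u) = cscale W c (map_poly (res M V W) u)"
  using assms unfolding psec_def
  by (intro poly_eqI) (simp add: coeff_cscale coeff_map_poly res_zero res_fmul rs_const)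

lemma res_pscale:
  assumes "opn V" "opn W" "W \<subseteq> V" "u \<in> psec M V"
  shows "map_poly (res M V W) (pscale X M V b u) = pscale X M W b (map_poly (res M V W) u)"
  using assms
  by (induction b) (simp_all add: pscale_zero pscale_pCons res_psec res_padd cscale_psec pscale_psec
      psec_pCons sec_zero res_cscale map_poly_pCons_zero res_zero)


section \<open>Operators with coefficients in the polynomials in s\<close>

lemma fs_ops_psec:
  assumes "opn V" "(P, T) \<in> fs_ops X f M V" "u \<in> psec M V"
  shows "T u \<in> psec M V"
  using assms(2,3)
proof (induction P T arbitrary: u rule: fs_ops.induct[split_format(complete)])
  case (func g)
  then show ?case using assms(1)
    by (intro psec_map_poly[where V = V]) (simp_all add: fmul_zero fmul_sec rs_hol)
next
  case (vf \<xi>)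
  have "\<xi> V (rs V f) \<in> hol X V"
    using vf.hyps assms(1) rs_f[OF assms(1)] unfolding vfields_def sheaf_end_def by auto
  then show ?case using vf assms(1)
    by (intro psec_add psec_pCons sec_zero psec_map_poly[where V = V])
      (simp_all add: act_zero act_sec vfields_diffops fmul_zero fmul_sec rs_hol fdiv_zero fdiv_sec)
qed (simp_all add: assms(1) psec_add)

text \<open>The action of an operator on \<open>M[s] f^s\<close> is compatible with restriction. For vector fields this
  holds because division by f is unique, hence compatible with restriction itself.\<close>

lemma fs_ops_res:
  assumes VW: "opn V" "opn W" "W \<subseteq> V" and "(P, T) \<in> fs_ops X f M V"
  shows "\<exists>Q S. (Q, S) \<in> fs_ops X f M W \<and>
    (\<forall>u\<in>psec M V. map_poly (res M V W) (T u) = S (map_poly (res M V W) u))"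
  using assms(4)
proof (induction P T rule: fs_ops.induct[split_format(complete)])
  case (func g)
  have "map_poly (res M V W) (map_poly (fmul X M V g) u)
      = map_poly (fmul X M W (rs W g)) (map_poly (res M V W) u)" if "u \<in> psec M V" for u
    using that VW func.hyps hol_rs[OF manifold VW(2,3)] unfolding psec_def
    by (intro poly_eqI) (simp add: coeff_map_poly fmul_zero res_zero res_fmul fmul_rs rs_hol)
  then show ?case using fs_ops.func[OF hol_rs[OF manifold VW(2,3) func.hyps]] by blast
next
  case (vf \<xi>)
  let ?g = "\<xi> V (rs V f)"
  have g: "?g \<in> hol X V" "dres W \<xi> W (rs W f) = rs W ?g"
    using vf.hyps VW rs_f[OF VW(1)] unfolding vfields_def sheaf_end_def dres_def
    by (auto simp flip: rs_rs[OF VW(3), of f])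
  have W: "rs W ?g \<in> hol X W" by (rule hol_rs[OF manifold VW(2,3) g(1)])
  have "map_poly (res M V W) (map_poly (act M V \<xi>) u
          + pCons 0 (map_poly (\<lambda>m. fdiv X f M V (fmul X M V ?g m)) u))
      = map_poly (act M W (dres W \<xi>)) (map_poly (res M V W) u)
          + pCons 0 (map_poly (\<lambda>m. fdiv X f M W (fmul X M W (dres W \<xi> W (rs W f)) m))
              (map_poly (res M V W) u))" if "u \<in> psec M V" for u
    using that VW vf.hyps g W dres_vfields[OF VW(3) vf.hyps] unfolding psec_def
    by (intro poly_eqI)
      (simp add: coeff_map_poly coeff_pCons act_zero act_sec vfields_diffops fmul_zero fmul_sec
        rs_hol fdiv_zero fdiv_sec res_zero sec_zero res_add res_act res_fmul res_fdiv fmul_rs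
        split: nat.split)
  then show ?case using fs_ops.vf[OF dres_vfields[OF VW(3) vf.hyps]] by blast
next
  case (add P S Q T)
  then obtain P' S' Q' T' where *: "(P', S') \<in> fs_ops X f M W" "(Q', T') \<in> fs_ops X f M W"
    "\<forall>u\<in>psec M V. map_poly (res M V W) (S u) = S' (map_poly (res M V W) u)"
    "\<forall>u\<in>psec M V. map_poly (res M V W) (T u) = T' (map_poly (res M V W) u)" by blast
  show ?case
    using *(3,4) VW fs_ops_psec[OF VW(1) add.hyps(1)] fs_ops_psec[OF VW(1) add.hyps(2)]
    by (intro exI[of _ "P' + Q'"], intro exI[of _ "\<lambda>u. S' u + T' u"],
        intro conjI[OF fs_ops.add[OF *(1,2)]]) (simp add: res_padd)
next
  case (comp P S Q T)
  then obtain P' S' Q' T' where *: "(P', S') \<in> fs_ops X f M W" "(Q', T') \<in> fs_ops X f M W"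
    "\<forall>u\<in>psec M V. map_poly (res M V W) (S u) = S' (map_poly (res M V W) u)"
    "\<forall>u\<in>psec M V. map_poly (res M V W) (T u) = T' (map_poly (res M V W) u)" by blast
  show ?case
    using *(3,4) fs_ops_psec[OF VW(1) comp.hyps(2)]
    by (intro exI[of _ "dcomp P' Q'"], intro exI[of _ "S' \<circ> T'"],
        intro conjI[OF fs_ops.comp[OF *(1,2)]]) simp
qed

lemma function_op:
  assumes "rs V g \<in> hol X V"
  shows "(mop X V (rs V g), map_poly (fmul X M V g)) \<in> fs_ops X f M V"
  using fs_ops.func[OF assms, where f = f and M = M] by (simp add: fmul_rs)

lemma zero_op:
  assumes "opn V"
  shows "(mop X V (rs V (\<lambda>x. 0)), cscale V 0) \<in> fs_ops X f M V"
  unfolding cscale_def by (rule function_op[OF rs_const[OF assms]])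

lemma Ds_image_psec:
  assumes "opn V" "u \<in> psec M V" "v \<in> Ds_image X f M V u"
  shows "v \<in> psec M V"
proof -
  obtain N P T where *: "\<And>i. i \<le> N \<Longrightarrow> (P i, T i) \<in> fs_ops X f M V"
    "v = (\<Sum>i\<le>N. (pCons 0 ^^ i) (T i u))"
    using assms(3) unfolding Ds_image_def by blast
  show ?thesis
    unfolding *(2) using psec_shift[OF assms(1) fs_ops_psec[OF assms(1) *(1) assms(2)]]
    by (intro psec_sum[OF assms(1)]) simp
qed

text \<open>An operator may be padded by zero coefficients, so that two operators have a common bound on
  their degrees in s.\<close>

lemma Ds_image_padded:
  assumes V: "opn V" "u \<in> psec M V" and "v \<in> Ds_image X f M V u"
  obtains N where "\<And>N'. N' \<ge> N \<Longrightarrow>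
    \<exists>P T. (\<forall>i\<le>N'. (P i, T i) \<in> fs_ops X f M V) \<and> v = (\<Sum>i\<le>N'. (pCons 0 ^^ i) (T i u))"
proof -
  obtain N P T where *: "\<And>i. i \<le> N \<Longrightarrow> (P i, T i) \<in> fs_ops X f M V"
    "v = (\<Sum>i\<le>N. (pCons 0 ^^ i) (T i u))"
    using assms(3) unfolding Ds_image_def by blast
  show ?thesis
  proof (rule that[of N])
    fix N' assume "N \<le> N'"
    let ?P = "\<lambda>i. if i \<le> N then P i else mop X V (rs V (\<lambda>x. 0))"
    let ?T = "\<lambda>i. if i \<le> N then T i else cscale V 0"
    have "v = (\<Sum>i\<le>N. (pCons 0 ^^ i) (?T i u))"
      unfolding *(2) by (rule sum.cong) auto
    also have "\<dots> = (\<Sum>i\<le>N'. (pCons 0 ^^ i) (?T i u))"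
      using \<open>N \<le> N'\<close> V by (intro sum.mono_neutral_left) (auto simp: cscale_zero shift_zero)
    finally show "\<exists>P T. (\<forall>i\<le>N'. (P i, T i) \<in> fs_ops X f M V) \<and> v = (\<Sum>i\<le>N'. (pCons 0 ^^ i) (T i u))"
      using *(1) zero_op[OF V(1)] by (intro exI[of _ ?P] exI[of _ ?T]) auto
  qed
qed

lemma Ds_image_add:
  assumes V: "opn V" "u \<in> psec M V" and vw: "v \<in> Ds_image X f M V u" "w \<in> Ds_image X f M V u"
  shows "v + w \<in> Ds_image X f M V u"
proof -
  obtain N1 where 1: "\<And>N'. N' \<ge> N1 \<Longrightarrow>
    \<exists>P T. (\<forall>i\<le>N'. (P i, T i) \<in> fs_ops X f M V) \<and> v = (\<Sum>i\<le>N'. (pCons 0 ^^ i) (T i u))"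
    using Ds_image_padded[OF V vw(1)] by blast
  obtain N2 where 2: "\<And>N'. N' \<ge> N2 \<Longrightarrow>
    \<exists>P T. (\<forall>i\<le>N'. (P i, T i) \<in> fs_ops X f M V) \<and> w = (\<Sum>i\<le>N'. (pCons 0 ^^ i) (T i u))"
    using Ds_image_padded[OF V vw(2)] by blast
  let ?N = "max N1 N2"
  obtain P T Q S where "\<forall>i\<le>?N. (P i, T i) \<in> fs_ops X f M V" "v = (\<Sum>i\<le>?N. (pCons 0 ^^ i) (T i u))"
    "\<forall>i\<le>?N. (Q i, S i) \<in> fs_ops X f M V" "w = (\<Sum>i\<le>?N. (pCons 0 ^^ i) (S i u))"
    using 1[of ?N] 2[of ?N] by auto
  note PQ = this
  have ops: "(P i + Q i, \<lambda>u. T i u + S i u) \<in> fs_ops X f M V" if "i \<le> ?N" for i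
    using fs_ops.add[OF PQ(1)[rule_format, OF that] PQ(3)[rule_format, OF that]] .
  have "v + w = (\<Sum>i\<le>?N. (pCons 0 ^^ i) (T i u + S i u))"
    unfolding PQ(2,4) by (simp only: shift_add sum.distrib)
  then show ?thesis unfolding Ds_image_def using ops
    by (intro CollectI exI[of _ ?N] exI[of _ "\<lambda>i. P i + Q i"] exI[of _ "\<lambda>i u. T i u + S i u"] conjI allI impI)
qed

lemma Ds_image_pCons0:
  assumes V: "opn V" "u \<in> psec M V" and "v \<in> Ds_image X f M V u"
  shows "pCons 0 v \<in> Ds_image X f M V u"
proof -
  obtain N P T where *: "\<And>i. i \<le> N \<Longrightarrow> (P i, T i) \<in> fs_ops X f M V"
    "v = (\<Sum>i\<le>N. (pCons 0 ^^ i) (T i u))"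
    using assms(3) unfolding Ds_image_def by blast
  (* multiplication by s moves every coefficient up by one degree *)
  let ?P = "case_nat (mop X V (rs V (\<lambda>x. 0))) P" and ?T = "case_nat (cscale V 0) T"
  have "pCons 0 v = (\<Sum>i\<le>Suc N. (pCons 0 ^^ i) (?T i u))"
    unfolding *(2) by (simp only: sum.atMost_Suc_shift pCons_sum) (simp add: cscale_zero V)
  moreover have "\<forall>i\<le>Suc N. (?P i, ?T i) \<in> fs_ops X f M V"
    using *(1) zero_op[OF V(1)] by (auto split: nat.split)
  ultimately show ?thesis unfolding Ds_image_def by blast
qed

lemma Ds_image_cscale:
  assumes V: "opn V" "u \<in> psec M V" and "v \<in> Ds_image X f M V u"
  shows "cscale V c v \<in> Ds_image X f M V u"
proof -
  obtain N P T where *: "\<And>i. i \<le> N \<Longrightarrow> (P i, T i) \<in> fs_ops X f M V"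
    "v = (\<Sum>i\<le>N. (pCons 0 ^^ i) (T i u))"
    using assms(3) unfolding Ds_image_def by blast
  have c: "(mop X V (rs V (\<lambda>x. c)), cscale V c) \<in> fs_ops X f M V"
    unfolding cscale_def by (rule function_op[OF rs_const[OF V(1)]])
  have "cscale V c v = (\<Sum>i\<le>N. cscale V c ((pCons 0 ^^ i) (T i u)))"
    unfolding *(2) cscale_def using V psec_shift[OF V(1) fs_ops_psec[OF V(1) *(1) V(2)]]
    by (intro map_poly_sum_psec[where V = V]) (simp_all add: fmul_zero fmul_add rs_const)
  also have "\<dots> = (\<Sum>i\<le>N. (pCons 0 ^^ i) ((cscale V c \<circ> T i) u))"
    using V by (simp add: cscale_def map_poly_shift fmul_zero rs_const)
  finally show ?thesis unfolding Ds_image_def using fs_ops.comp[OF c *(1)]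
    by (intro CollectI exI[of _ N] exI[of _ "\<lambda>i. dcomp (mop X V (rs V (\<lambda>x. c))) (P i)"]
        exI[of _ "\<lambda>i. cscale V c \<circ> T i"]) simp
qed

text \<open>The image of u under the operators with coefficients polynomial in s is a module over the
  polynomials in s: constants are absorbed into the coefficients by composition with a multiplication
  operator, and multiplication by s shifts the coefficients.\<close>

lemma Ds_image_pscale:
  assumes V: "opn V" "u \<in> psec M V" and v: "v \<in> Ds_image X f M V u"
  shows "pscale X M V b v \<in> Ds_image X f M V u"
proof (induction b)
  case 0
  then show ?case using Ds_image_cscale[OF assms, of 0] V Ds_image_psec[OF assms]
    by (simp add: pscale_zero cscale_zero)
next
  case (pCons a b)
  then show ?case using V Ds_image_psec[OF assms]
    by (simp add: pscale_pCons Ds_image_add[OF V] Ds_image_cscale[OF assms] Ds_image_pCons0[OF V])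
qed

lemma Ds_image_res:
  assumes VW: "opn V" "opn W" "W \<subseteq> V" and u: "u \<in> psec M V" and "v \<in> Ds_image X f M V u"
  shows "map_poly (res M V W) v \<in> Ds_image X f M W (map_poly (res M V W) u)"
proof -
  obtain N P T where *: "\<And>i. i \<le> N \<Longrightarrow> (P i, T i) \<in> fs_ops X f M V"
    "v = (\<Sum>i\<le>N. (pCons 0 ^^ i) (T i u))"
    using assms(5) unfolding Ds_image_def by blast
  have "\<forall>i\<in>{..N}. \<exists>R. R \<in> fs_ops X f M W \<and>
    map_poly (res M V W) (T i u) = snd R (map_poly (res M V W) u)"
  proof
    fix i assume "i \<in> {..N}"
    then obtain Q S where "(Q, S) \<in> fs_ops X f M W"
      "\<forall>u\<in>psec M V. map_poly (res M V W) (T i u) = S (map_poly (res M V W) u)"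
      using fs_ops_res[OF VW *(1)[of i]] by auto
    then show "\<exists>R. R \<in> fs_ops X f M W \<and>
        map_poly (res M V W) (T i u) = snd R (map_poly (res M V W) u)"
      using u by (intro exI[of _ "(Q, S)"]) simp
  qed
  from bchoice[OF this] obtain R where R: "\<And>i. i \<le> N \<Longrightarrow> R i \<in> fs_ops X f M W"
    "\<And>i. i \<le> N \<Longrightarrow> map_poly (res M V W) (T i u) = snd (R i) (map_poly (res M V W) u)"
    by auto
  have "map_poly (res M V W) v = (\<Sum>i\<le>N. map_poly (res M V W) ((pCons 0 ^^ i) (T i u)))"
    unfolding *(2) using VW psec_shift[OF VW(1) fs_ops_psec[OF VW(1) *(1) u]]
    by (intro map_poly_sum_psec[where V = V]) (simp_all add: res_zero res_add)
  also have "\<dots> = (\<Sum>i\<le>N. (pCons 0 ^^ i) (snd (R i) (map_poly (res M V W) u)))"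
    using VW R(2) by (intro sum.cong) (simp_all add: map_poly_shift res_zero)
  finally show ?thesis unfolding Ds_image_def using R(1)
    by (intro CollectI exI[of _ N] exI[of _ "fst \<circ> R"] exI[of _ "snd \<circ> R"]) simp
qed

text \<open>The source of the monotonicity in k: an operator P applied to \<open>m f^(s+k+1)\<close> is P f applied to
  \<open>m f^(s+k)\<close>.\<close>

lemma Ds_image_fmul_f:
  assumes V: "opn V" "a \<in> sec M V"
  shows "Ds_image X f M V [:fmul X M V f a:] \<subseteq> Ds_image X f M V [:a:]"
proof
  fix v assume "v \<in> Ds_image X f M V [:fmul X M V f a:]"
  then obtain N P T where *: "\<And>i. i \<le> N \<Longrightarrow> (P i, T i) \<in> fs_ops X f M V"
    "v = (\<Sum>i\<le>N. (pCons 0 ^^ i) (T i [:fmul X M V f a:]))"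
    unfolding Ds_image_def by blast
  have F: "(mop X V (rs V f), map_poly (fmul X M V f)) \<in> fs_ops X f M V"
    by (rule function_op[OF rs_f[OF V(1)]])
  have "v = (\<Sum>i\<le>N. (pCons 0 ^^ i) ((T i \<circ> map_poly (fmul X M V f)) [:a:]))"
    unfolding *(2) using V by (simp add: map_poly_pCons_zero fmul_zero rs_f)
  then show "v \<in> Ds_image X f M V [:a:]"
    unfolding Ds_image_def using fs_ops.comp[OF *(1) F]
    by (intro CollectI exI[of _ N] exI[of _ "\<lambda>i. dcomp (P i) (mop X V (rs V f))"]
        exI[of _ "\<lambda>i. T i \<circ> map_poly (fmul X M V f)"]) simp
qed

end


section \<open>The b-function as the generator of an ideal\<close>

text \<open>Division with remainder: the remainder of an element of the ideal modulo a non-zero element of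
  minimal degree is again in the ideal, hence zero.\<close>

lemma poly_ideal_generator:
  fixes I :: "'a::field poly set"
  assumes add: "\<forall>b\<in>I. \<forall>c\<in>I. b + c \<in> I"
    and mult: "\<forall>b\<in>I. \<forall>c. c * b \<in> I"
    and ex: "\<exists>b\<in>I. b \<noteq> 0"
  defines "minimal \<equiv> \<lambda>g. g \<in> I \<and> lead_coeff g = 1 \<and> (\<forall>c\<in>I. c \<noteq> 0 \<longrightarrow> degree g \<le> degree c)"
  shows "\<exists>!g. minimal g" and "minimal g \<Longrightarrow> c \<in> I \<Longrightarrow> g dvd c"
proof -
  have dvd: "g dvd c" if g: "minimal g" and c: "c \<in> I" for g c
  proof (rule ccontr)
    assume "\<not> g dvd c"
    then have nz: "c mod g \<noteq> 0" by (simp add: mod_eq_0_iff_dvd)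
    have "c mod g = c + (- (c div g)) * g"
      by (simp add: minus_div_mult_eq_mod[symmetric])
    then have "c mod g \<in> I" using g c add mult unfolding minimal_def by metis
    then have "degree g \<le> degree (c mod g)" using g nz unfolding minimal_def by blast
    moreover have "degree (c mod g) < degree g"
      using g nz degree_mod_less'[of g c] unfolding minimal_def by fastforce
    ultimately show False by simp
  qed
  then show "minimal g \<Longrightarrow> c \<in> I \<Longrightarrow> g dvd c" .
  obtain b where b: "b \<in> I" "b \<noteq> 0" "\<And>c. c \<in> I \<Longrightarrow> c \<noteq> 0 \<Longrightarrow> degree b \<le> degree c"
    using ex exists_least_iff[of "\<lambda>n. \<exists>b\<in>I. b \<noteq> 0 \<and> degree b = n"] by (metis not_le)
  have "smult (inverse (lead_coeff b)) b \<in> I"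
    using mult[rule_format, OF b(1), of "[:inverse (lead_coeff b):]"] by simp
  then have "minimal (smult (inverse (lead_coeff b)) b)"
    unfolding minimal_def using b by simp
  moreover have "g = h" if "minimal g" "minimal h" for g h
  proof -
    have g: "g \<noteq> 0" "lead_coeff g = 1" and h: "h \<noteq> 0" "lead_coeff h = 1"
      using that unfolding minimal_def by auto
    have deg: "degree g = degree h"
      using that g(1) h(1) unfolding minimal_def by (intro order.antisym) blast+
    have "g dvd h" using that unfolding minimal_def by (intro dvd) (simp_all add: minimal_def)
    then obtain k where k: "h = g * k" by (rule dvdE)
    then have "k \<noteq> 0" using h(1) by auto
    then have "degree k = 0" using deg g(1) by (simp add: k degree_mult_eq)
    moreover have "lead_coeff k = 1" using g(2) h(2) by (simp add: k lead_coeff_mult)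
    ultimately have "k = 1" by (metis degree_0_id one_pCons)
    then show ?thesis using k by simp
  qed
  ultimately show "\<exists>!g. minimal g" by blast
qed

context localized_module
begin

lemma b_ideal_mult:
  assumes U: "opn U" "m \<in> sec M U" and "b \<in> b_ideal X f M U m k"
  shows "c * b \<in> b_ideal X f M U m k"
proof -
  have "pscale X M V (c * b) [:res M U V m:] \<in> Ds_image X f M V [:(fmul X M V f ^^ k) (res M U V m):]"
    if V: "opn V" "V \<subseteq> U"
      and b: "pscale X M V b [:res M U V m:] \<in> Ds_image X f M V [:(fmul X M V f ^^ k) (res M U V m):]"
    for V
  proof -
    have "res M U V m \<in> sec M V" using U V by (simp add: res_sec)
    then have "[:res M U V m:] \<in> psec M V" "[:(fmul X M V f ^^ k) (res M U V m):] \<in> psec M V"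
      using V by (simp_all add: psec_pCons psec_zero fmul_f_power_sec)
    then show ?thesis using V(1) b by (simp add: pscale_mult Ds_image_pscale)
  qed
  then show ?thesis using assms(3) unfolding b_ideal_def by blast
qed

text \<open>Two functional equations live on two neighbourhoods of a point; they can be added after
  restriction to the intersection.\<close>

lemma b_ideal_add:
  assumes U: "opn U" "m \<in> sec M U"
    and bc: "b \<in> b_ideal X f M U m k" "c \<in> b_ideal X f M U m k"
  shows "b + c \<in> b_ideal X f M U m k"
  unfolding b_ideal_def
proof (intro CollectI ballI)
  fix x assume "x \<in> U"
  have restrict: "pscale X M W d [:res M U W m:] \<in> Ds_image X f M W [:(fmul X M W f ^^ k) (res M U W m):]"
    if V: "opn V" "V \<subseteq> U" and W: "opn W" "W \<subseteq> V"
      and d: "pscale X M V d [:res M U V m:] \<in> Ds_image X f M V [:(fmul X M V f ^^ k) (res M U V m):]"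
    for V W d
  proof -
    have s: "res M U V m \<in> sec M V" using U V by (simp add: res_sec)
    then have p: "[:res M U V m:] \<in> psec M V" "[:(fmul X M V f ^^ k) (res M U V m):] \<in> psec M V"
      using V by (simp_all add: psec_pCons psec_zero fmul_f_power_sec)
    have "map_poly (res M V W) (pscale X M V d [:res M U V m:])
        \<in> Ds_image X f M W (map_poly (res M V W) [:(fmul X M V f ^^ k) (res M U V m):])"
      using Ds_image_res[OF V(1) W p(2) d] .
    then show ?thesis using U V W s p
      by (simp add: res_pscale map_poly_pCons_zero res_zero res_fmul_f_power res_res)
  qed
  obtain V1 where V1: "opn V1" "x \<in> V1" "V1 \<subseteq> U"
    "pscale X M V1 b [:res M U V1 m:] \<in> Ds_image X f M V1 [:(fmul X M V1 f ^^ k) (res M U V1 m):]"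
    using bc(1) \<open>x \<in> U\<close> unfolding b_ideal_def by blast
  obtain V2 where V2: "opn V2" "x \<in> V2" "V2 \<subseteq> U"
    "pscale X M V2 c [:res M U V2 m:] \<in> Ds_image X f M V2 [:(fmul X M V2 f ^^ k) (res M U V2 m):]"
    using bc(2) \<open>x \<in> U\<close> unfolding b_ideal_def by blast
  let ?W = "V1 \<inter> V2"
  have W: "opn ?W" "?W \<subseteq> V1" "?W \<subseteq> V2" using V1 V2 by auto
  have "res M U ?W m \<in> sec M ?W" using U V1(3) W by (simp add: res_sec inf.coboundedI1)
  then have "[:res M U ?W m:] \<in> psec M ?W" "[:(fmul X M ?W f ^^ k) (res M U ?W m):] \<in> psec M ?W"
    using W by (simp_all add: psec_pCons psec_zero fmul_f_power_sec)
  then have "pscale X M ?W (b + c) [:res M U ?W m:]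
      \<in> Ds_image X f M ?W [:(fmul X M ?W f ^^ k) (res M U ?W m):]"
    using W restrict[OF V1(1,3) W(1,2) V1(4)] restrict[OF V2(1,3) W(1,3) V2(4)]
    by (simp add: pscale_plus Ds_image_add)
  then show "\<exists>V. opn V \<and> x \<in> V \<and> V \<subseteq> U \<and>
      pscale X M V (b + c) [:res M U V m:] \<in> Ds_image X f M V [:(fmul X M V f ^^ k) (res M U V m):]"
    using W V1 V2 by blast
qed

lemma b_function_generates:
  assumes U: "opn U" "m \<in> sec M U" and ex: "\<exists>b\<in>b_ideal X f M U m k. b \<noteq> 0"
  shows "b_function X f M U m k \<in> b_ideal X f M U m k" and "b_function X f M U m k \<noteq> 0"
    and "c \<in> b_ideal X f M U m k \<Longrightarrow> b_function X f M U m k dvd c"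
proof -
  let ?I = "b_ideal X f M U m k"
  let ?min = "\<lambda>g. g \<in> ?I \<and> lead_coeff g = 1 \<and> (\<forall>c\<in>?I. c \<noteq> 0 \<longrightarrow> degree g \<le> degree c)"
  have "\<forall>b\<in>?I. \<forall>c\<in>?I. b + c \<in> ?I" "\<forall>b\<in>?I. \<forall>c. c * b \<in> ?I"
    by (intro ballI allI b_ideal_add[OF U] b_ideal_mult[OF U]; assumption)+
  note gen = poly_ideal_generator[OF this ex]
  have eq: "b_function X f M U m k = (THE g. ?min g)"
    using ex unfolding b_function_def by simp
  have min: "?min (b_function X f M U m k)"
    unfolding eq using gen(1) by (rule theI')
  then show "b_function X f M U m k \<in> ?I" "b_function X f M U m k \<noteq> 0" by auto
  show "c \<in> ?I \<Longrightarrow> b_function X f M U m k dvd c"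
    using gen(2)[OF min] .
qed


section \<open>Comparison of the two sequences\<close>

lemma Ds_image_Suc_power:
  assumes "opn U" "m \<in> sec M U" "opn V" "V \<subseteq> U"
  shows "Ds_image X f M V [:(fmul X M V f ^^ Suc k) (res M U V m):]
    \<subseteq> Ds_image X f M V [:(fmul X M V f ^^ k) (res M U V m):]"
  using Ds_image_fmul_f[of V "(fmul X M V f ^^ k) (res M U V m)"] assms
  by (simp add: fmul_f_power_sec res_sec)

lemma locally_mono:
  assumes "\<forall>x\<in>U. \<exists>V. opn V \<and> x \<in> V \<and> V \<subseteq> U \<and> A V"
    and "\<And>V. opn V \<Longrightarrow> V \<subseteq> U \<Longrightarrow> A V \<Longrightarrow> B V"
  shows "\<forall>x\<in>U. \<exists>V. opn V \<and> x \<in> V \<and> V \<subseteq> U \<and> B V"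
  using assms by blast

lemma ell_mono:
  assumes U: "opn U" "m \<in> sec M U"
  shows "ell X f M U m \<alpha> k \<le> ell X f M U m \<alpha> (Suc k)"
  unfolding ell_def
proof (intro Inf_superset_mono Collect_mono impI, elim exE conjE, intro exI conjI, assumption)
  fix l
  assume "\<forall>x\<in>U. \<exists>V. opn V \<and> x \<in> V \<and> V \<subseteq> U \<and> (\<exists>u\<in>psec M V.
      pscale X M V ([:\<alpha>, 1:] ^ l) [:res M U V m:] + pscale X M V ([:\<alpha>, 1:] ^ (l + 1)) u
        \<in> Ds_image X f M V [:(fmul X M V f ^^ Suc k) (res M U V m):])"
  then show "\<forall>x\<in>U. \<exists>V. opn V \<and> x \<in> V \<and> V \<subseteq> U \<and> (\<exists>u\<in>psec M V.
      pscale X M V ([:\<alpha>, 1:] ^ l) [:res M U V m:] + pscale X M V ([:\<alpha>, 1:] ^ (l + 1)) u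
        \<in> Ds_image X f M V [:(fmul X M V f ^^ k) (res M U V m):])"
  proof (rule locally_mono)
    fix V assume V: "opn V" "V \<subseteq> U"
      and "\<exists>u\<in>psec M V.
        pscale X M V ([:\<alpha>, 1:] ^ l) [:res M U V m:] + pscale X M V ([:\<alpha>, 1:] ^ (l + 1)) u
          \<in> Ds_image X f M V [:(fmul X M V f ^^ Suc k) (res M U V m):]"
    then show "\<exists>u\<in>psec M V.
        pscale X M V ([:\<alpha>, 1:] ^ l) [:res M U V m:] + pscale X M V ([:\<alpha>, 1:] ^ (l + 1)) u
          \<in> Ds_image X f M V [:(fmul X M V f ^^ k) (res M U V m):]"
      using subsetD[OF Ds_image_Suc_power[OF U V, of k]] by (elim bexE, intro bexI)
  qed
qed

lemma b_ideal_Suc: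
  assumes U: "opn U" "m \<in> sec M U"
  shows "b_ideal X f M U m (Suc k) \<subseteq> b_ideal X f M U m k"
  unfolding b_ideal_def
  by (intro Collect_mono impI, erule locally_mono) (rule subsetD[OF Ds_image_Suc_power[OF U]])

lemma root_mult_b_function_mono:
  assumes U: "opn U" "m \<in> sec M U"
  shows "root_mult z (b_function X f M U m k) \<le> root_mult z (b_function X f M U m (Suc k))"
proof (cases "\<exists>b\<in>b_ideal X f M U m (Suc k). b \<noteq> 0")
  case True
  note Suc = b_function_generates[OF U True]
  have in_k: "b_function X f M U m (Suc k) \<in> b_ideal X f M U m k"
    using Suc(1) b_ideal_Suc[OF U] by blast
  then have "b_function X f M U m k dvd b_function X f M U m (Suc k)"
    using Suc(2) b_function_generates(3)[OF U] by blast
  then show ?thesis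
    using Suc(2) by (auto simp: root_mult_def dvd_imp_order_le)
next
  case False
  then have "b_function X f M U m (Suc k) = 0" unfolding b_function_def by simp
  then show ?thesis by (simp add: root_mult_def)
qed

text \<open>Write \<open>b = (s + \<alpha>)^l q\<close> with \<open>q(-\<alpha>) \<noteq> 0\<close>. Up to the non-zero factor \<open>q(-\<alpha>)\<close> the polynomial q is 1
  modulo \<open>s + \<alpha>\<close>, so the functional equation for b is one for \<open>(s + \<alpha>)^l\<close> modulo \<open>(s + \<alpha>)^(l+1)\<close>.\<close>

lemma ell_le_order:
  assumes U: "opn U" "m \<in> sec M U" and b: "b \<in> b_ideal X f M U m k" "b \<noteq> 0"
  shows "ell X f M U m \<alpha> k \<le> enat (order (- \<alpha>) b)"
proof -
  define l where "l = order (- \<alpha>) b"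
  obtain q where q: "b = [:\<alpha>, 1:] ^ l * q" "\<not> [:\<alpha>, 1:] dvd q"
    using order_decomp[OF b(2), of "- \<alpha>"] unfolding l_def by auto
  have nz: "poly q (- \<alpha>) \<noteq> 0"
    using q(2) poly_eq_0_iff_dvd[of q "- \<alpha>"] by simp
  (* r is the quotient of q - q(-\<alpha>) by s + \<alpha>, divided by q(-\<alpha>) *)
  define r where "r = smult (inverse (poly q (- \<alpha>))) (synthetic_div q (- \<alpha>))"
  have hq: "smult (inverse (poly q (- \<alpha>))) q = 1 + [:\<alpha>, 1:] * r"
  proof -
    have "q = [:\<alpha>, 1:] * synthetic_div q (- \<alpha>) + [:poly q (- \<alpha>):]"
      using synthetic_div_correct'[of "- \<alpha>" q] by simp
    then have "smult (inverse (poly q (- \<alpha>))) q = smult (inverse (poly q (- \<alpha>)))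
        ([:\<alpha>, 1:] * synthetic_div q (- \<alpha>) + [:poly q (- \<alpha>):])" by simp
    also have "\<dots> = 1 + [:\<alpha>, 1:] * r"
      using nz by (simp add: r_def smult_add_right one_pCons)
    finally show ?thesis .
  qed
  have "[:inverse (poly q (- \<alpha>)):] * b = [:\<alpha>, 1:] ^ l * smult (inverse (poly q (- \<alpha>))) q"
    by (simp add: q(1))
  then have eq: "[:inverse (poly q (- \<alpha>)):] * b = [:\<alpha>, 1:] ^ l + [:\<alpha>, 1:] ^ (l + 1) * r"
    by (simp only: hq distrib_left mult_1_right power_add power_one_right mult.assoc)
  have step: "\<exists>u\<in>psec M V. pscale X M V ([:\<alpha>, 1:] ^ l) [:res M U V m:] + pscale X M V ([:\<alpha>, 1:] ^ (l + 1)) u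
      \<in> Ds_image X f M V [:(fmul X M V f ^^ k) (res M U V m):]"
    if V: "opn V" "V \<subseteq> U" and bV: "pscale X M V ([:inverse (poly q (- \<alpha>)):] * b) [:res M U V m:]
      \<in> Ds_image X f M V [:(fmul X M V f ^^ k) (res M U V m):]" for V
  proof -
    have p: "[:res M U V m:] \<in> psec M V"
      using U V by (simp add: res_sec psec_pCons psec_zero)
    show ?thesis
      using bV V p unfolding eq
      by (intro bexI[of _ "pscale X M V r [:res M U V m:]"])
        (simp_all only: pscale_plus pscale_mult pscale_psec)
  qed
  have "[:inverse (poly q (- \<alpha>)):] * b \<in> b_ideal X f M U m k"
    by (rule b_ideal_mult[OF U b(1)])
  then have "\<forall>x\<in>U. \<exists>V. opn V \<and> x \<in> V \<and> V \<subseteq> U \<and> (\<exists>u\<in>psec M V.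
      pscale X M V ([:\<alpha>, 1:] ^ l) [:res M U V m:] + pscale X M V ([:\<alpha>, 1:] ^ (l + 1)) u
        \<in> Ds_image X f M V [:(fmul X M V f ^^ k) (res M U V m):])"
    unfolding b_ideal_def mem_Collect_eq by (rule locally_mono) (rule step)
  then show ?thesis
    unfolding ell_def l_def[symmetric] by (intro Inf_lower CollectI exI[of _ l] conjI HOL.refl)
qed

lemma ell_le_root_mult:
  assumes U: "opn U" "m \<in> sec M U"
  shows "ell X f M U m \<alpha> k \<le> root_mult (- \<alpha>) (b_function X f M U m k)"
proof (cases "\<exists>b\<in>b_ideal X f M U m k. b \<noteq> 0")
  case True
  then show ?thesis
    using ell_le_order[OF U] b_function_generates[OF U True] by (simp add: root_mult_def)
next
  case False
  then show ?thesis by (simp add: b_function_def root_mult_def)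
qed

end

theorem proposition1p5:
  fixes X :: "'x cmanifold" and f :: "'x \<Rightarrow> complex"
    and S :: "('x, 's::ab_group_add) dmodule" and M :: "('x, 'm::ab_group_add) dmodule"
    and \<iota> :: "'x set \<Rightarrow> 's \<Rightarrow> 'm" and \<alpha> :: complex and U :: "'x set" and m :: 'm
  assumes "complex_manifold X" and "quasi_projective X"
    and "f \<in> hol X (topspace (mtop X))"
    and "\<not> (\<exists>g\<in>hol X (topspace (mtop X)). \<forall>x\<in>topspace (mtop X). f x * g x = 1)"
    and "D_module X S" and "simple_module X S" and "regular_holonomic X S"
    and "is_localization X f S M \<iota>" and "\<not> zero_module X M"
    and "openin (mtop X) U" and "m \<in> sec M U"
  shows "omega X f M U m \<alpha> \<le> nu X f M U m \<alpha>"
proof -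
  interpret localized_module X f M
    using assms(1,3,8) unfolding is_localization_def by unfold_locales blast+
  let ?l = "ell X f M U m \<alpha>" and ?r = "\<lambda>k. root_mult (- \<alpha>) (b_function X f M U m k)"
  have "incseq ?l" "incseq ?r"
    using ell_mono[OF assms(10,11)] root_mult_b_function_mono[OF assms(10,11)]
    by (simp_all add: incseq_SucI)
  note lim = this[THEN LIMSEQ_SUP]
  have "(SUP k. ?l k) \<le> (SUP k. ?r k)"
    using ell_le_root_mult[OF assms(10,11)] by (intro SUP_mono') blast
  then show ?thesis
    unfolding omega_def nu_def by (simp add: limI[OF lim(1)] limI[OF lim(2)])
qed

end
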